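(* Let $X\subset\mathbb P^4$ be an irreducible cubic hypersurface with vanishing hessian which is not a cone. Then: (i) $(\operatorname{Sing}X)_{\rm red}$ is a plane $\mathbb P^2\subset\mathbb P^4$; (ii) the dual variety $X^*\subset(\mathbb P^4)^*\simeq\mathbb P^4$ is projectively equivalent to the cubic rational normal scroll $S(1,2)\subset\mathbb P^4$; (iii) $X$ is projectively equivalent to a linear external projection of the Segre variety $\operatorname{Seg}(1,2)=\mathbb P^1\times\mathbb P^2\subset\mathbb P^5$, that is, to its image in $\mathbb P^4$ under projection from a point of $\mathbb P^5\setminus\operatorname{Seg}(1,2)$; (iv) $X$ is projectively equivalent to $V(x_0x_3^2+2x_1x_3x_4+x_2x_4^2)\subset\mathbb P^4$.
   Context: The ground field $\mathbb K$ is algebraically closed of characteristic zero. For $X=V(f)\subset\mathbb P^N$ with $f\in\mathbb K[x_0,\dots,x_N]$ homogeneous and reduced, $X$ has vanishing hessian if the determinant of the Hessian matrix $\left[\frac{\partial^2f}{\partial x_i\partial x_j}\right]_{0\le i,j\le N}$ is identically zero. $X$ is a cone if there is a point $p\in X$ such that the line $\langle p,q\rangle$ is contained in $X$ for every $q\in X$, $q\neq p$. $\operatorname{Sing}X=V(\frac{\partial f}{\partial x_0},\dots,\frac{\partial f}{\partial x_N})$ is the singular scheme and $(\operatorname{Sing}X)_{\rm red}$ its underlying reduced variety. $X^*$ is the closure of the set of hyperplanes tangent to $X$ at smooth points. $S(1,2)\subset\mathbb P^4$ is the smooth rational normal surface scroll of degree 3. *)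

theory Defs
  imports "HOL-Analysis.Analysis" "HOL-Library.Poly_Mapping"
    "HOL-Computational_Algebra.Polynomial"
begin

unbundle no fps_syntax

section \<open>Polynomials in variables indexed by a finite type\<close>

text \<open>A monomial is its exponent vector, a polynomial is a finitely supported family of
  coefficients; multiplication is the convolution product of \<^theory>\<open>HOL-Library.Poly_Mapping\<close>.\<close>

type_synonym ('n, 'a) mpol = "('n \<Rightarrow>\<^sub>0 nat) \<Rightarrow>\<^sub>0 'a"

definition mvar :: "'n \<Rightarrow> ('n, 'a::comm_ring_1) mpol" where
  "mvar i = Poly_Mapping.single (Poly_Mapping.single i 1) 1"

definition meval :: "('n::finite, 'a::comm_ring_1) mpol \<Rightarrow> 'a ^ 'n \<Rightarrow> 'a" where
  "meval f v = (\<Sum>m\<in>Poly_Mapping.keys f.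
      Poly_Mapping.lookup f m * (\<Prod>i\<in>UNIV. (v $ i) ^ Poly_Mapping.lookup m i))"

text \<open>Where the exponent of the variable is zero the subtraction of exponents truncates, but the
  coefficient is then zero as well.\<close>

definition mderiv :: "'n \<Rightarrow> ('n, 'a::comm_ring_1) mpol \<Rightarrow> ('n, 'a) mpol" where
  "mderiv i f = (\<Sum>m\<in>Poly_Mapping.keys f.
      Poly_Mapping.single (m - Poly_Mapping.single i 1)
        (of_nat (Poly_Mapping.lookup m i) * Poly_Mapping.lookup f m))"

definition homogeneous :: "nat \<Rightarrow> ('n::finite, 'a::comm_ring_1) mpol \<Rightarrow> bool" where
  "homogeneous d f \<longleftrightarrow> (\<forall>m\<in>Poly_Mapping.keys f. (\<Sum>i\<in>UNIV. Poly_Mapping.lookup m i) = d)"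

definition hessian :: "('n::finite, 'a::comm_ring_1) mpol \<Rightarrow> ('n, 'a) mpol ^ 'n ^ 'n" where
  "hessian f = (\<chi> i j. mderiv i (mderiv j f))"

definition vanishing_hessian :: "('n::finite, 'a::comm_ring_1) mpol \<Rightarrow> bool" where
  "vanishing_hessian f \<longleftrightarrow> det (hessian f) = 0"

section \<open>Projective space\<close>

text \<open>The points of the projective space of \<open>'a ^ 'n\<close> (of dimension \<open>CARD('n) - 1\<close>) are the lines
  through the origin.\<close>

definition pt :: "'a::field ^ 'n \<Rightarrow> ('a ^ 'n) set" where
  "pt v = vec.span {v}"

definition proj_linear :: "('a::field ^ 'n) set \<Rightarrow> ('a ^ 'n) set set" where
  "proj_linear W = {pt w |w. w \<in> W \<and> w \<noteq> 0}"

definition proj_plane :: "('a::field ^ 'n) set set \<Rightarrow> bool" where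
  "proj_plane S \<longleftrightarrow> (\<exists>W. vec.subspace W \<and> vec.dim W = 3 \<and> S = proj_linear W)"

definition line_through :: "('a::field ^ 'n) set \<Rightarrow> ('a ^ 'n) set \<Rightarrow> ('a ^ 'n) set set" where
  "line_through p q = proj_linear (vec.span (p \<union> q))"

text \<open>Only meaningful for sets of homogeneous polynomials.\<close>

definition proj_zeros :: "('n::finite, 'a::field) mpol set \<Rightarrow> ('a ^ 'n) set set" where
  "proj_zeros F = {pt v |v. v \<noteq> 0 \<and> (\<forall>f\<in>F. meval f v = 0)}"

definition zariski_closed :: "('a::field ^ 'n::finite) set set \<Rightarrow> bool" where
  "zariski_closed Z \<longleftrightarrow> (\<exists>F. (\<forall>f\<in>F. \<exists>d. homogeneous d f) \<and> Z = proj_zeros F)"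

definition zariski_closure :: "('a::field ^ 'n::finite) set set \<Rightarrow> ('a ^ 'n) set set" where
  "zariski_closure S = \<Inter>{Z. zariski_closed Z \<and> S \<subseteq> Z}"

definition is_cone :: "('a::field ^ 'n) set set \<Rightarrow> bool" where
  "is_cone X \<longleftrightarrow> (\<exists>p\<in>X. \<forall>q\<in>X. q \<noteq> p \<longrightarrow> line_through p q \<subseteq> X)"

text \<open>The image of a set of points under the rational map given by a matrix; it is only used for
  sets that avoid the projectivization of the kernel.\<close>

definition proj_image :: "'a::field ^ 'n ^ 'm \<Rightarrow> ('a ^ 'n) set set \<Rightarrow> ('a ^ 'm) set set" where
  "proj_image A S = (\<lambda>p. (\<lambda>v. A *v v) ` p) ` S"

definition proj_equivalent :: "('a::field ^ 'n) set set \<Rightarrow> ('a ^ 'n) set set \<Rightarrow> bool" where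
  "proj_equivalent X Y \<longleftrightarrow> (\<exists>A :: 'a ^ 'n ^ 'n. invertible A \<and> proj_image A X = Y)"

section \<open>Singular locus and dual variety of a hypersurface\<close>

definition sing_red :: "('n::finite, 'a::field) mpol \<Rightarrow> ('a ^ 'n) set set" where
  "sing_red f = proj_zeros (range (\<lambda>i. mderiv i f))"

definition hyperplane :: "'a::field ^ 'n \<Rightarrow> ('a ^ 'n::finite) set" where
  "hyperplane a = {w. (\<Sum>i\<in>UNIV. a $ i * w $ i) = 0}"

text \<open>The affine cone over the embedded projective tangent space at the point \<open>pt v\<close>.\<close>

definition tangent_space :: "('n::finite, 'a::field) mpol \<Rightarrow> 'a ^ 'n \<Rightarrow> ('a ^ 'n) set" where
  "tangent_space f v = {w. (\<Sum>i\<in>UNIV. meval (mderiv i f) v * w $ i) = 0}"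

text \<open>The dual projective space is identified with projective space through the coefficients of the
  equation of a hyperplane.\<close>

definition dual_variety :: "('n::finite, 'a::field) mpol \<Rightarrow> ('a ^ 'n) set set" where
  "dual_variety f = zariski_closure
     {pt a |a. a \<noteq> 0 \<and> (\<exists>v. v \<noteq> 0 \<and> pt v \<in> proj_zeros {f} - sing_red f \<and>
                            hyperplane a = tangent_space f v)}"

section \<open>The scroll S(1,2) and the Segre variety Seg(1,2)\<close>

text \<open>The union of the lines joining corresponding points \<open>(s : t : 0 : 0 : 0)\<close> and
  \<open>(0 : 0 : s\<^sup>2 : s t : t\<^sup>2)\<close> of a line and a conic in complementary subspaces.\<close>

definition scroll_1_2 :: "('a::field ^ 5) set set" where
  "scroll_1_2 = {pt w |w. \<exists>s t a b. (s, t) \<noteq> (0, 0) \<and> (a, b) \<noteq> (0, 0) \<and>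
     w $ 0 = a * s \<and> w $ 1 = a * t \<and>
     w $ 2 = b * s ^ 2 \<and> w $ 3 = b * (s * t) \<and> w $ 4 = b * t ^ 2}"

text \<open>The coordinates of the five-dimensional projective space are indexed by the pairs of a
  coordinate of the line and a coordinate of the plane.\<close>

definition segre_1_2 :: "('a::field ^ (2 \<times> 3)) set set" where
  "segre_1_2 = {pt (\<chi> ij. a $ fst ij * b $ snd ij) |(a :: 'a ^ 2) (b :: 'a ^ 3). a \<noteq> 0 \<and> b \<noteq> 0}"

text \<open>A linear map with kernel the line \<open>p\<close>; for a target of dimension one less than the source it
  is surjective by rank-nullity.\<close>

definition projection_from :: "('a::field ^ 'n) set \<Rightarrow> 'a ^ 'n ^ 'm \<Rightarrow> bool" where
  "projection_from p M \<longleftrightarrow> {v. M *v v = 0} = p"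

end

theory Submission
  imports Defs
begin

text \<open>The polarization of a cubic form \<open>f\<close> is encoded by a commutative product \<open>x \<star> y\<close> on \<open>'a ^ 5\<close>
  with symmetric trilinear form \<open>dot (x \<star> y) z\<close>, so that \<open>f x = dot (x \<star> x) x\<close> and the Hessian
  matrix at \<open>x\<close> is six times the matrix of \<open>(\<star>) x\<close>. If the hypersurface is not a cone, then only \<open>y = 0\<close>
  satisfies \<open>x \<star> y = 0\<close> for all \<open>x\<close>; if the Hessian determinant vanishes, then every \<open>(\<star>) x\<close> is
  singular.

  Call \<open>x\<close> generic if \<open>(\<star>) x\<close> has the largest possible rank and \<open>f x \<noteq> 0\<close>. Semicontinuity of
  the rank along lines through such a point (\<open>range_persists_at_maximal_rank\<close>) gives, for a kernel
  vector \<open>y\<close> of \<open>(\<star>) x\<close>, first and second order conditions in the manner of Gordan and Noether: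
  each \<open>w \<star> y\<close> can be written as \<open>x \<star> z\<close>, and the vectors \<open>z\<close> so obtained are isotropic for the
  quadratic form of \<open>(\<star>) x\<close> (\<open>kernel_range_subset\<close>, \<open>kernel_lift_isotropic2\<close>). If the range of \<open>(\<star>) y\<close>
  contained two independent functionals, they would vanish on \<open>x\<close>, \<open>y\<close> and two lifts \<open>z1\<close>, \<open>z2\<close>, which
  are four independent vectors of a space of dimension five. Hence \<open>(\<star>) y\<close> has rank one, that is, the
  derivative of \<open>f\<close> in the direction \<open>y\<close> is up to a factor the square of a linear form \<open>l\<close>
  (\<open>generic_kernel_rank_one\<close>).

  Varying \<open>x\<close> gives pairwise independent such forms \<open>l1\<close>, \<open>l2\<close>, \<open>l3\<close>. Symmetry forces all of them to
  vanish on all the vertices \<open>y1\<close>, \<open>y2\<close>, \<open>y3\<close>, and a second dimension count shows that they span only a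
  plane. So the derivatives of \<open>f\<close> in the directions of the span of \<open>y1\<close>, \<open>y2\<close>, \<open>y3\<close> are all the
  quadratic forms in two variables (\<open>polar_net\<close>), and the remaining cubic in these two variables is
  absorbed by a change of coordinates (\<open>normal_form\<close>). The four assertions are then calculations with
  the normal form: the singular locus is \<open>x\<^sub>3 = x\<^sub>4 = 0\<close>, the cubic has a bilinear parametrization
  by a line and a plane (\<open>proj_image_segre\<close>), and the gradients at its smooth points are the points of
  the scroll off its directrix line (\<open>dual_variety_f\<close>).\<close>

section \<open>Linear algebra over a field\<close>

text \<open>The standard symmetric bilinear form, through which vectors also serve as linear functionals.\<close>

definition dot :: "'a::comm_semiring_1 ^ 'n::finite \<Rightarrow> 'a ^ 'n \<Rightarrow> 'a" where
  "dot v w = (\<Sum>i\<in>UNIV. v $ i * w $ i)"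

lemma dot_add_left: "dot (u + v) w = dot u w + dot v w"
  by (simp add: dot_def sum.distrib algebra_simps)

lemma dot_scale_left: "dot (c *s v) w = c * dot v w"
  by (simp add: dot_def sum_distrib_left algebra_simps)

lemma dot_zero_left [simp]: "dot 0 w = 0"
  by (simp add: dot_def)

lemma dot_commute: "dot v w = dot w v"
  by (simp add: dot_def mult.commute)

lemma dot_add_right: "dot w (u + v) = dot w u + dot w v"
  by (metis dot_add_left dot_commute)

lemma dot_scale_right: "dot w (c *s v) = c * dot w v"
  by (metis dot_scale_left dot_commute)

lemma dot_zero_right [simp]: "dot w 0 = 0"
  by (simp add: dot_def)

lemma dot_axis: "dot v (axis i 1) = v $ i"
  by (simp add: dot_def axis_def if_distrib[where f="\<lambda>x. _ * x"] cong: if_cong)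

lemmas dot_simps = dot_add_left dot_add_right dot_scale_left dot_scale_right

lemma dot_eqI:
  fixes u v :: "'a::comm_ring_1 ^ 'n::finite"
  assumes "\<And>w. dot u w = dot v w"
  shows "u = v"
  using assms[of "axis _ 1"] by (simp add: dot_axis vec_eq_iff)

lemma linear_vecI:
  fixes h :: "'a::field ^ 'n \<Rightarrow> 'a ^ 'm"
  assumes "\<And>u v. h (u + v) = h u + h v" and "\<And>c v. h (c *s v) = c *s h v"
  shows "Vector_Spaces.linear (*s) (*s) h"
  by unfold_locales (use assms in auto)

text \<open>The functionals \<open>dot i\<close>, \<open>i\<close> in an independent set, take arbitrary prescribed values at a
  suitable common vector.\<close>

lemma independent_functionals_solvable:
  fixes I :: "('a::field ^ 'n::finite) set" and c :: "'a ^ 'n \<Rightarrow> 'a"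
  assumes "vec.independent I"
  obtains v where "\<And>i. i \<in> I \<Longrightarrow> dot i v = c i"
proof -
  obtain g :: "'a ^ 'n \<Rightarrow> 'a ^ 'n" where g: "Vector_Spaces.linear (*s) (*s) g"
    and gI: "\<forall>i\<in>I. g i = (\<chi> k. c i)"
    using vec.linear_independent_extend[OF assms, of "\<lambda>i. (\<chi> k. c i)"] by auto
  \<comment> \<open>All coordinates of \<open>g w\<close> agree for \<open>w \<in> I\<close>, so that any fixed index serves.\<close>
  define v :: "'a ^ 'n" where "v = (\<chi> j. g (axis j 1) $ undefined)"
  have "dot w v = g w $ undefined" for w
    unfolding linear_componentwise[OF g, of w] by (simp add: dot_def v_def)
  with gI show thesis by (intro that[of v]) simp
qed

text \<open>Independent vectors and independent functionals that vanish on them are together at most as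
  many as the dimension of the space.\<close>

lemma card_annihilator_le:
  fixes J S :: "('a::field ^ 'n::finite) set"
  assumes J: "vec.independent J" and S: "vec.independent S"
    and orth: "\<And>i s. i \<in> J \<Longrightarrow> s \<in> S \<Longrightarrow> dot i s = 0"
  shows "card J + card S \<le> CARD('n)"
proof -
  have fin: "finite J" "finite S"
    using J S vec.finiteI_independent by auto
  have "\<exists>v. \<forall>i. \<forall>j\<in>J. dot j (v i) = (if i = j then 1 else 0)"
  proof (intro choice allI)
    fix i
    obtain v where "\<And>j. j \<in> J \<Longrightarrow> dot j v = (if i = j then 1 else 0)"
      using independent_functionals_solvable[OF J, of "\<lambda>j. if i = j then 1 else 0"] by blast
    then show "\<exists>v. \<forall>j\<in>J. dot j v = (if i = j then 1 else 0)" by blast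
  qed
  then obtain v where v: "\<And>i j. j \<in> J \<Longrightarrow> dot j (v i) = (if i = j then 1 else 0)"
    by blast
  \<comment> \<open>The vectors dual to \<open>J\<close> can be added to \<open>S\<close> one at a time.\<close>
  have main: "vec.independent (S \<union> v ` K) \<and> card (S \<union> v ` K) = card S + card K"
    if "finite K" "K \<subseteq> J" for K
    using that
  proof (induction K rule: finite_induct)
    case empty
    show ?case using S by simp
  next
    case (insert k K)
    have k: "k \<in> J" "K \<subseteq> J" using insert.prems by auto
    have sub: "S \<union> v ` K \<subseteq> {x. dot k x = 0}"
      using orth[OF k(1)] v[OF k(1)] insert.hyps by auto
    have "vec.subspace {x. dot k x = 0}"
      by (auto simp: vec.subspace_def dot_simps)
    then have "vec.span (S \<union> v ` K) \<subseteq> {x. dot k x = 0}"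
      using sub by (rule vec.span_minimal[rotated])
    moreover have "dot k (v k) \<noteq> 0" using v[OF k(1), of k] by simp
    ultimately have notin: "v k \<notin> vec.span (S \<union> v ` K)" by auto
    have "v k \<notin> S \<union> v ` K" by (meson notin vec.span_base)
    moreover have IH: "vec.independent (S \<union> v ` K)" "card (S \<union> v ` K) = card S + card K"
      using insert.IH[OF k(2)] by auto
    ultimately show ?case
      using insert.hyps fin vec.independent_insertI[OF notin IH(1)] by simp
  qed
  have "card (S \<union> v ` J) \<le> CARD('n)"
    using vec.independent_bound_general[of "S \<union> v ` J"] main[OF fin(1) order_refl]
      vec.dim_subset_UNIV[of "S \<union> v ` J"] vec.dim_eq_card_independent[of "S \<union> v ` J"]
    by (simp add: vec.dimension_def card_cart_basis)
  then show ?thesis using main[OF fin(1) order_refl] by simp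
qed

text \<open>The dimension formula for two spanning subspaces, as an inequality; \<open>I\<close> is an independent set in
  their intersection.\<close>

lemma dim_sums_UNIV:
  fixes U W I :: "('a::field ^ 'n::finite) set"
  assumes UW: "\<And>v. \<exists>x\<in>U. \<exists>y\<in>W. v = x + y"
    and I: "I \<subseteq> U" "I \<subseteq> W" "vec.independent I"
  shows "CARD('n) + card I \<le> vec.dim U + vec.dim W"
proof -
  obtain B where B: "I \<subseteq> B" "B \<subseteq> U" "vec.independent B" "U \<subseteq> vec.span B"
    using vec.maximal_independent_subset_extend[OF I(1,3)] by metis
  obtain C where C: "I \<subseteq> C" "C \<subseteq> W" "vec.independent C" "W \<subseteq> vec.span C"
    using vec.maximal_independent_subset_extend[OF I(2,3)] by metis
  have fin: "finite B" "finite C"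
    using vec.finiteI_independent[OF B(3)] vec.finiteI_independent[OF C(3)] by auto
  have "v \<in> vec.span (B \<union> C)" for v
  proof -
    obtain x y where "x \<in> U" "y \<in> W" "v = x + y" using UW by blast
    moreover have "vec.span B \<subseteq> vec.span (B \<union> C)" "vec.span C \<subseteq> vec.span (B \<union> C)"
      by (simp_all add: vec.span_mono)
    ultimately show ?thesis using B C by (auto intro!: vec.span_add)
  qed
  then have "vec.dim (UNIV :: ('a ^ 'n) set) \<le> card (B \<union> C)"
    using fin by (intro vec.dim_le_card) auto
  then have "CARD('n) \<le> card (B \<union> C)" by (simp add: card_cart_basis)
  moreover have "card (B \<union> C) + card (B \<inter> C) = card B + card C"
    using card_Un_Int[OF fin] by simp
  moreover have "card I \<le> card (B \<inter> C)"
    using B(1) C(1) fin by (intro card_mono) auto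
  moreover have "card B = vec.dim U" "card C = vec.dim W"
    using vec.basis_card_eq_dim[OF B(2,4,3)] vec.basis_card_eq_dim[OF C(2,4,3)] by auto
  ultimately show ?thesis by linarith
qed

text \<open>A matrix becomes invertible after adding a matrix whose range is a complement of its range;
  the complement can be chosen through any given vector outside the range.\<close>

lemma complementary_matrix:
  fixes A :: "'a::field ^ 'n ^ 'n::finite"
  assumes u: "u \<notin> range ((*v) A)"
  obtains N :: "'a ^ 'n ^ 'n" where "vec.dim (range ((*v) N)) + vec.dim (range ((*v) A)) \<le> CARD('n)"
    "invertible (A + N)" "u \<in> range ((*v) N)"
proof -
  let ?K = "{v. A *v v = 0}"
  obtain BK where BK: "BK \<subseteq> ?K" "vec.independent BK" "?K \<subseteq> vec.span BK"
    using vec.maximal_independent_subset[of ?K] by blast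
  obtain B where B: "BK \<subseteq> B" "vec.independent B" "UNIV \<subseteq> vec.span B"
    using vec.maximal_independent_subset_extend[OF subset_UNIV BK(2)] by metis
  have finB: "finite B" using B vec.finiteI_independent by auto
  have spanB: "vec.span B = UNIV" using B by auto
  let ?D = "B - BK"
  have AK: "A *v b = 0" if "b \<in> BK" for b using BK that by auto
  have inj: "inj_on ((*v) A) (vec.span ?D)"
  proof -
    \<comment> \<open>The projection along the kernel separates the span of \<open>?D\<close> from the kernel.\<close>
    obtain p :: "'a ^ 'n \<Rightarrow> 'a ^ 'n" where p: "Vector_Spaces.linear (*s) (*s) p"
      "\<forall>b\<in>B. p b = (if b \<in> BK then 0 else b)"
      using vec.linear_independent_extend[OF B(2), of "\<lambda>b. if b \<in> BK then 0 else b"] by auto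
    have pD: "p x = id x" if "x \<in> vec.span ?D" for x
      using p(2) that by (intro vec.linear_eq_on[OF p(1) vec.linear_id that]) auto
    have pK: "p x = 0" if "x \<in> vec.span BK" for x
      using p(2) that B(1) by (intro vec.linear_eq_on[OF p(1) vec.module_hom_zero that]) auto
    have "x = 0" if x: "x \<in> vec.span ?D" "A *v x = 0" for x
      using pD[OF x(1)] pK[of x] x BK(3) by auto
    then show ?thesis
      by (subst vec.linear_inj_on_iff_eq_0) auto
  qed
  have iD: "vec.independent ?D" using B(2) vec.independent_mono by blast
  have iAD: "vec.independent ((*v) A ` ?D)"
    using vec.linear_independent_injective_image[OF _ iD inj] by simp
  have "(*v) A ` ?D \<subseteq> range ((*v) A)" by auto
  moreover have "vec.subspace (range ((*v) A))"
    by (simp add: vec.linear_subspace_image)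
  ultimately have "vec.span ((*v) A ` ?D) \<subseteq> range ((*v) A)"
    by (rule vec.span_minimal)
  then have uD: "u \<notin> vec.span ((*v) A ` ?D)" using u by auto
  obtain C where C: "insert u ((*v) A ` ?D) \<subseteq> C" "vec.independent C" "UNIV \<subseteq> vec.span C"
    using vec.maximal_independent_subset_extend[OF subset_UNIV vec.independent_insertI[OF uD iAD]]
    by metis
  have finC: "finite C" using C vec.finiteI_independent by auto
  have cards: "card B = CARD('n)" "card C = CARD('n)"
    using vec.basis_card_eq_dim[OF subset_UNIV B(3,2)] vec.basis_card_eq_dim[OF subset_UNIV C(3,2)]
    by (simp_all add: card_cart_basis)
  have cAD: "card ((*v) A ` ?D) = card ?D"
    using inj_on_subset[OF inj vec.span_superset] by (rule card_image)
  have cD: "card ?D + card BK = CARD('n)"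
    using cards finB B(1) by (metis card_Diff_subset card_mono finite_subset le_add_diff_inverse2)
  \<comment> \<open>The matrix \<open>N\<close> kills the complement \<open>?D\<close> of the kernel and maps a basis of the kernel bijectively to
    a basis \<open>?E\<close> of a complement of the range.\<close>
  let ?E = "C - (*v) A ` ?D"
  have "card ?E = card BK"
    using cards cAD cD C(1) finC finB by (simp add: card_Diff_subset)
  moreover have "finite BK" "finite ?E" using finB finC B(1) finite_subset by auto
  ultimately obtain \<phi> where \<phi>: "bij_betw \<phi> BK ?E"
    using finite_same_card_bij[of BK ?E] by auto
  then have \<phi>E: "?E = \<phi> ` BK" by (simp add: bij_betw_def)
  obtain g :: "'a ^ 'n \<Rightarrow> 'a ^ 'n" where g: "Vector_Spaces.linear (*s) (*s) g"
    "\<forall>b\<in>B. g b = (if b \<in> BK then \<phi> b else 0)"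
    using vec.linear_independent_extend[OF B(2), of "\<lambda>b. if b \<in> BK then \<phi> b else 0"] by auto
  define N where "N = matrix g"
  have Ng: "N *v v = g v" for v by (simp add: N_def matrix_works[OF g(1)])
  have img: "range ((*v) L) = vec.span ((*v) L ` B)" for L :: "'a ^ 'n ^ 'n"
    using vec.linear_span_image[of "(*v) L" B] spanB by simp
  have "vec.dim (range ((*v) A)) \<le> card ?D"
  proof -
    have "(*v) A ` B \<subseteq> insert 0 ((*v) A ` ?D)" using AK by auto
    then have "range ((*v) A) \<subseteq> vec.span ((*v) A ` ?D)"
      unfolding img by (metis vec.span_insert_0 vec.span_mono)
    then show ?thesis
      using vec.dim_le_card[of _ "(*v) A ` ?D"] finB cAD by auto
  qed
  moreover have "vec.dim (range ((*v) N)) \<le> card BK"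
  proof -
    have "(*v) N ` B \<subseteq> insert 0 (\<phi> ` BK)" using g(2) Ng by auto
    then have "range ((*v) N) \<subseteq> vec.span (\<phi> ` BK)"
      unfolding img by (metis vec.span_insert_0 vec.span_mono)
    then have "vec.dim (range ((*v) N)) \<le> card (\<phi> ` BK)"
      using \<open>finite BK\<close> by (intro vec.dim_le_card) auto
    then show ?thesis using bij_betw_same_card[OF \<phi>] \<phi> by (simp add: bij_betw_def)
  qed
  ultimately have 1: "vec.dim (range ((*v) N)) + vec.dim (range ((*v) A)) \<le> CARD('n)"
    using cD by linarith
  have "C \<subseteq> (*v) (A + N) ` B"
  proof
    fix c assume c: "c \<in> C"
    show "c \<in> (*v) (A + N) ` B"
    proof (cases "c \<in> ?E")
      case True
      then obtain b where b: "b \<in> BK" "c = \<phi> b" using \<phi>E by blast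
      then have "(A + N) *v b = c" using AK[OF b(1)] g(2) B(1) Ng
        by (auto simp: matrix_vector_mult_add_rdistrib)
      then show ?thesis using b B(1) by blast
    next
      case False
      then obtain b where b: "b \<in> ?D" "c = A *v b" using c by auto
      then have "(A + N) *v b = c" using g(2) Ng
        by (auto simp: matrix_vector_mult_add_rdistrib)
      then show ?thesis using b by blast
    qed
  qed
  then have "vec.span C \<subseteq> range ((*v) (A + N))"
    unfolding img by (rule vec.span_mono)
  then have "surj ((*v) (A + N))" using C(3) by auto
  then have 2: "invertible (A + N)"
    using matrix_right_invertible_surjective invertible_right_inverse by blast
  have "u \<in> ?E" using C(1) uD vec.span_superset[of "(*v) A ` ?D"] by auto
  then obtain b where "b \<in> BK" "u = \<phi> b" using \<phi>E by blast
  then have "u = N *v b" using g(2) Ng B(1) by auto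
  then have 3: "u \<in> range ((*v) N)" by auto
  show thesis using that[OF 1 2 3] .
qed

section \<open>Functions that are polynomial on lines\<close>

text \<open>Functions whose restriction to every line is a polynomial in the parameter. Over an infinite integral
  domain two such functions that are not identically zero have a common point where neither vanishes
  (\<open>line_poly_generic\<close>), which replaces the irreducibility of affine space.\<close>

definition line_poly :: "('a::comm_ring_1 ^ 'n \<Rightarrow> 'a) \<Rightarrow> bool" where
  "line_poly g \<longleftrightarrow> (\<forall>x w. \<exists>p. \<forall>t. g (x + t *s w) = poly p t)"

lemma line_poly_const [intro]: "line_poly (\<lambda>x. c)"
  unfolding line_poly_def by (intro allI exI[of _ "[:c:]"]) simp

lemma line_poly_component [intro]: "line_poly (\<lambda>x. x $ i)"
  unfolding line_poly_def
proof (intro allI)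
  fix x w :: "'a ^ 'b"
  show "\<exists>p. \<forall>t. (x + t *s w) $ i = poly p t"
    by (intro exI[of _ "[:x $ i, w $ i:]"]) (simp add: mult.commute)
qed

lemma line_poly_add [intro]:
  assumes "line_poly g" "line_poly h" shows "line_poly (\<lambda>x. g x + h x)"
  using assms unfolding line_poly_def by (metis poly_add)

lemma line_poly_mult [intro]:
  assumes "line_poly g" "line_poly h" shows "line_poly (\<lambda>x. g x * h x)"
  using assms unfolding line_poly_def by (metis poly_mult)

lemma line_poly_sum [intro]:
  assumes "\<And>i. i \<in> I \<Longrightarrow> line_poly (g i)" shows "line_poly (\<lambda>x. \<Sum>i\<in>I. g i x)"
  using assms by (induction I rule: infinite_finite_induct) auto

lemma line_poly_prod [intro]:
  assumes "\<And>i. i \<in> I \<Longrightarrow> line_poly (g i)" shows "line_poly (\<lambda>x. \<Prod>i\<in>I. g i x)"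
  using assms by (induction I rule: infinite_finite_induct) auto

lemma line_poly_power [intro]:
  assumes "line_poly g" shows "line_poly (\<lambda>x. g x ^ k)"
  using assms by (induction k) auto

lemma line_poly_det:
  assumes "\<And>i j. line_poly (\<lambda>x. L x $ i $ j)" shows "line_poly (\<lambda>x. det (L x))"
  unfolding det_def by (intro line_poly_sum line_poly_mult line_poly_const line_poly_prod assms)

lemma line_poly_generic:
  fixes g h :: "'a::{idom, ring_char_0} ^ 'n \<Rightarrow> 'a"
  assumes "line_poly g" "line_poly h" "g x \<noteq> 0" "h y \<noteq> 0"
  obtains z where "g z \<noteq> 0" "h z \<noteq> 0"
proof -
  obtain p q where p: "\<And>t. g (x + t *s (y - x)) = poly p t" and q: "\<And>t. h (x + t *s (y - x)) = poly q t"
    using assms(1,2) unfolding line_poly_def by metis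
  have "poly p 0 \<noteq> 0" "poly q 1 \<noteq> 0"
    using p[of 0] q[of 1] assms(3,4) by auto
  then have "p * q \<noteq> 0" by auto
  then obtain t where "poly (p * q) t \<noteq> 0"
    using poly_all_0_iff_0 by blast
  then show thesis using that[of "x + t *s (y - x)"] p q by auto
qed

lemma line_poly_zero_on_punctured_line:
  fixes g :: "'a::{idom, ring_char_0} ^ 'n \<Rightarrow> 'a"
  assumes "line_poly g" "\<And>t. t \<noteq> 0 \<Longrightarrow> g (x + t *s w) = 0"
  shows "g x = 0"
proof -
  obtain p where p: "\<And>t. g (x + t *s w) = poly p t"
    using assms(1) unfolding line_poly_def by metis
  have "[:0, 1:] * p = 0"
    by (subst poly_all_0_iff_0[symmetric]) (use p assms(2) in auto)
  then have "p = 0" by simp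
  then show ?thesis using p[of 0] by simp
qed

text \<open>A vector in the range of all other members of a pencil of matrices is in the range of a member of
  largest rank. Otherwise the complement of that range in \<open>complementary_matrix\<close>, chosen through the
  vector, would remain a complement of some other range in the pencil, and yet contain a nonzero vector
  of it.\<close>

lemma range_persists_at_maximal_rank:
  fixes A B :: "'a::field_char_0 ^ 'n ^ 'n::finite"
  assumes rank: "\<And>t. vec.dim (range ((*v) (A + (\<chi> i j. t * B $ i $ j)))) \<le> vec.dim (range ((*v) A))"
    and u: "\<And>t. t \<noteq> 0 \<Longrightarrow> u \<in> range ((*v) (A + (\<chi> i j. t * B $ i $ j)))"
  shows "u \<in> range ((*v) A)"
proof (rule ccontr)
  assume nu: "u \<notin> range ((*v) A)"
  then obtain N where N: "vec.dim (range ((*v) N)) + vec.dim (range ((*v) A)) \<le> CARD('n)"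
    "invertible (A + N)" "u \<in> range ((*v) N)"
    by (rule complementary_matrix)
  let ?P = "\<lambda>t. A + (\<chi> i j. t * B $ i $ j)"
  let ?d = "\<lambda>x :: 'a ^ 1. det (?P (x $ 1) + N)"
  have "line_poly ?d"
    by (intro line_poly_det) (simp, intro line_poly_add line_poly_mult line_poly_const line_poly_component)
  moreover have "?d 0 \<noteq> 0"
  proof -
    have "?P 0 = A" by (simp add: vec_eq_iff)
    then show ?thesis using N(2) by (simp add: invertible_det_nz)
  qed
  ultimately obtain x where x: "?d x \<noteq> 0" "x $ 1 \<noteq> 0"
    using line_poly_generic[of ?d "\<lambda>x. x $ 1" 0 "axis 1 1"] by (auto simp: axis_def)
  let ?t = "x $ 1"
  have "surj ((*v) (?P ?t + N))"
    using x(1) unfolding invertible_det_nz[symmetric] invertible_right_inverse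
      matrix_right_invertible_surjective .
  then have "\<exists>a\<in>range ((*v) (?P ?t)). \<exists>b\<in>range ((*v) N). v = a + b" for v
  proof -
    obtain z where "v = (?P ?t + N) *v z"
      using \<open>surj ((*v) (?P ?t + N))\<close> by (auto simp: surj_def)
    then have "v = ?P ?t *v z + N *v z"
      by (simp only: matrix_vector_mult_add_rdistrib)
    then show ?thesis by blast
  qed
  moreover have "u \<noteq> 0" using nu by (metis matrix_vector_mult_0_right rangeI)
  ultimately have "CARD('n) + card {u} \<le> vec.dim (range ((*v) (?P ?t))) + vec.dim (range ((*v) N))"
    using u[OF x(2)] N(3) by (intro dim_sums_UNIV) auto
  then show False using rank[of ?t] N(1) by simp
qed

section \<open>Evaluation and differentiation of polynomials\<close>

text \<open>The value at \<open>v\<close> of the monomial with exponent vector \<open>m\<close>.\<close>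

definition monomial :: "'a::comm_ring_1 ^ 'n::finite \<Rightarrow> ('n \<Rightarrow>\<^sub>0 nat) \<Rightarrow> 'a" where
  "monomial v m = (\<Prod>i\<in>UNIV. (v $ i) ^ Poly_Mapping.lookup m i)"

lemma mpol_expand: "f = (\<Sum>m\<in>Poly_Mapping.keys f. Poly_Mapping.single m (Poly_Mapping.lookup f m))"
  by (rule poly_mapping_eqI)
    (simp add: lookup_sum lookup_single when_def in_keys_iff)

lemma meval_superset:
  assumes "finite S" "Poly_Mapping.keys f \<subseteq> S"
  shows "meval f v = (\<Sum>m\<in>S. Poly_Mapping.lookup f m * monomial v m)"
  unfolding meval_def monomial_def using assms
  by (intro sum.mono_neutral_left) (auto simp: in_keys_iff)

lemma meval_keys: "meval f v = (\<Sum>m\<in>Poly_Mapping.keys f. Poly_Mapping.lookup f m * monomial v m)"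
  by (rule meval_superset) auto

lemma meval_zero [simp]: "meval 0 v = 0"
  by (simp add: meval_def)

lemma meval_single: "meval (Poly_Mapping.single m c) v = c * monomial v m"
  by (subst meval_superset[of "{m}"]) auto

lemma meval_add: "meval (f + g) v = meval f v + meval g v"
  using Poly_Mapping.keys_add[of f g]
  by (simp add: meval_superset[of "Poly_Mapping.keys f \<union> Poly_Mapping.keys g"] lookup_add
      sum.distrib algebra_simps)

lemma meval_sum: "meval (sum F S) v = (\<Sum>s\<in>S. meval (F s) v)"
  by (induction S rule: infinite_finite_induct) (auto simp: meval_add)

lemma monomial_add: "monomial v (m + n) = monomial v m * monomial v n"
  by (simp add: monomial_def lookup_add power_add prod.distrib)

lemma monomial_zero [simp]: "monomial v 0 = 1"
  by (simp add: monomial_def)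

lemma monomial_single: "monomial v (Poly_Mapping.single i k) = v $ i ^ k"
  by (simp add: monomial_def lookup_single when_def if_distrib[where f="\<lambda>k. _ ^ k"] cong: if_cong)

lemma meval_mult: "meval (f * g) v = meval f v * meval g v"
proof -
  have "f * g = (\<Sum>m\<in>Poly_Mapping.keys f. Poly_Mapping.single m (Poly_Mapping.lookup f m)) *
      (\<Sum>n\<in>Poly_Mapping.keys g. Poly_Mapping.single n (Poly_Mapping.lookup g n))"
    by (simp flip: mpol_expand)
  also have "\<dots> = (\<Sum>m\<in>Poly_Mapping.keys f. \<Sum>n\<in>Poly_Mapping.keys g.
      Poly_Mapping.single (m + n) (Poly_Mapping.lookup f m * Poly_Mapping.lookup g n))"
    by (simp add: sum_product mult_single)
  finally have "meval (f * g) v = (\<Sum>m\<in>Poly_Mapping.keys f. \<Sum>n\<in>Poly_Mapping.keys g.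
      Poly_Mapping.lookup f m * Poly_Mapping.lookup g n * monomial v (m + n))"
    by (simp only: meval_sum meval_single)
  then show ?thesis
    by (simp add: monomial_add sum_product mult_ac meval_keys[of f] meval_keys[of g])
qed

lemma meval_one [simp]: "meval 1 v = 1"
  using meval_single[of 0 1 v] by simp

lemma meval_numeral [simp]: "meval (numeral k) v = numeral k"
  using meval_single[of 0 "numeral k" v] by simp

lemma meval_uminus: "meval (- f) v = - meval f v"
  using meval_add[of f "- f" v] by (simp add: eq_neg_iff_add_eq_0 add.commute)

lemma meval_diff: "meval (f - g) v = meval f v - meval g v"
  using meval_add[of f "- g" v] by (simp add: meval_uminus)

lemma meval_power: "meval (f ^ k) v = meval f v ^ k"
  by (induction k) (auto simp: meval_mult)

lemma meval_prod: "meval (prod F S) v = (\<Prod>s\<in>S. meval (F s) v)"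
  by (induction S rule: infinite_finite_induct) (auto simp: meval_mult)

lemma meval_mvar [simp]: "meval (mvar i) v = v $ i"
  by (simp add: mvar_def meval_single monomial_single)

lemmas meval_simps = meval_add meval_mult meval_diff meval_power

lemma meval_det:
  fixes A :: "('n::finite, 'a::comm_ring_1) mpol ^ 'm ^ 'm::finite"
  shows "meval (det A) v = det (\<chi> i j. meval (A $ i $ j) v)"
proof -
  have "meval (of_int (sign p)) v = of_int (sign p)" for p :: "'m \<Rightarrow> 'm"
    by (simp add: sign_def meval_uminus)
  then show ?thesis
    by (simp add: det_def meval_sum meval_mult meval_prod)
qed

lemma line_poly_meval: "line_poly (\<lambda>v. meval f v)"
  unfolding meval_def
  by (intro line_poly_sum line_poly_mult line_poly_const line_poly_prod line_poly_power
      line_poly_component)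

lemma mderiv_superset:
  assumes "finite S" "Poly_Mapping.keys f \<subseteq> S"
  shows "mderiv i f = (\<Sum>m\<in>S. Poly_Mapping.single (m - Poly_Mapping.single i 1)
        (of_nat (Poly_Mapping.lookup m i) * Poly_Mapping.lookup f m))"
  unfolding mderiv_def using assms
  by (intro sum.mono_neutral_left) (auto simp: in_keys_iff)

lemma mderiv_zero [simp]: "mderiv i 0 = 0"
  by (simp add: mderiv_def)

lemma mderiv_add: "mderiv i (f + g) = mderiv i f + mderiv i g"
  using Poly_Mapping.keys_add[of f g]
  by (simp add: mderiv_superset[of "Poly_Mapping.keys f \<union> Poly_Mapping.keys g"] lookup_add
      sum.distrib algebra_simps single_add)

lemma mderiv_sum: "mderiv i (sum F S) = (\<Sum>s\<in>S. mderiv i (F s))"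
  by (induction S rule: infinite_finite_induct) (auto simp: mderiv_add)

lemma mderiv_single: "mderiv i (Poly_Mapping.single m c) =
    Poly_Mapping.single (m - Poly_Mapping.single i 1) (of_nat (Poly_Mapping.lookup m i) * c)"
  by (subst mderiv_superset[of "{m}"]) auto

lemma mderiv_commute: "mderiv i (mderiv j f) = mderiv j (mderiv i f)"
proof -
  have "mderiv i (mderiv j (Poly_Mapping.single m c)) = mderiv j (mderiv i (Poly_Mapping.single m c))"
    for m and c :: 'b
    by (cases "i = j")
      (auto simp: mderiv_single lookup_minus lookup_single when_def algebra_simps
        diff_diff_add add.commute)
  then show ?thesis
    by (subst (1 2) mpol_expand[of f]) (simp only: mderiv_sum)
qed

lemma homogeneous_zero [simp]: "homogeneous d 0"
  by (simp add: homogeneous_def)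

lemma homogeneous_add: "homogeneous d f \<Longrightarrow> homogeneous d g \<Longrightarrow> homogeneous d (f + g)"
  unfolding homogeneous_def using Poly_Mapping.keys_add[of f g] by blast

lemma homogeneous_uminus: "homogeneous d f \<Longrightarrow> homogeneous d (- f)"
  unfolding homogeneous_def by (simp add: in_keys_iff)

lemma homogeneous_diff: "homogeneous d f \<Longrightarrow> homogeneous d g \<Longrightarrow> homogeneous d (f - g)"
  using homogeneous_add[of d f "- g"] homogeneous_uminus[of d g] by simp

lemma homogeneous_sum:
  "(\<And>s. s \<in> S \<Longrightarrow> homogeneous d (F s)) \<Longrightarrow> homogeneous d (sum F S)"
  by (induction S rule: infinite_finite_induct) (auto simp: homogeneous_add)

lemma homogeneous_mult:
  assumes "homogeneous d f" "homogeneous e g" shows "homogeneous (d + e) (f * g)"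
  unfolding homogeneous_def
proof
  fix m assume "m \<in> Poly_Mapping.keys (f * g)"
  then obtain a b where "m = a + b" "a \<in> Poly_Mapping.keys f" "b \<in> Poly_Mapping.keys g"
    using Poly_Mapping.keys_mult[of f g] by blast
  then show "(\<Sum>i\<in>UNIV. Poly_Mapping.lookup m i) = d + e"
    using assms by (simp add: homogeneous_def lookup_add sum.distrib)
qed

lemma homogeneous_single:
  "(\<Sum>i\<in>UNIV. Poly_Mapping.lookup m i) = d \<Longrightarrow> homogeneous d (Poly_Mapping.single m c)"
  by (simp add: homogeneous_def)

lemma sum_lookup_single: "(\<Sum>i\<in>UNIV. Poly_Mapping.lookup (Poly_Mapping.single (j::'n::finite) k) i) = k"
  by (simp add: lookup_single when_def)

lemma homogeneous_linear_form: "homogeneous 1 (\<Sum>i\<in>UNIV. Poly_Mapping.single (Poly_Mapping.single i 1) (a $ i))"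
  by (intro homogeneous_sum homogeneous_single sum_lookup_single)

lemma single_plus_minus:
  "Poly_Mapping.lookup m i \<noteq> 0 \<Longrightarrow> Poly_Mapping.single i 1 + (m - Poly_Mapping.single i 1) = (m :: 'n \<Rightarrow>\<^sub>0 nat)"
  by (rule poly_mapping_eqI) (auto simp: lookup_add lookup_minus lookup_single when_def)

lemma homogeneous_mderiv:
  assumes "homogeneous d f" shows "homogeneous (d - 1) (mderiv i f)"
  unfolding mderiv_def
proof (rule homogeneous_sum)
  fix m assume m: "m \<in> Poly_Mapping.keys f"
  let ?m = "m - Poly_Mapping.single i 1"
  show "homogeneous (d - 1) (Poly_Mapping.single ?m
      (of_nat (Poly_Mapping.lookup m i) * Poly_Mapping.lookup f m))"
  proof (cases "Poly_Mapping.lookup m i = 0")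
    case False
    have "d = (\<Sum>j\<in>UNIV. Poly_Mapping.lookup (Poly_Mapping.single i 1 + ?m) j)"
      using assms m single_plus_minus[OF False] by (simp add: homogeneous_def)
    also have "\<dots> = 1 + (\<Sum>j\<in>UNIV. Poly_Mapping.lookup ?m j)"
      by (simp only: lookup_add sum.distrib sum_lookup_single)
    finally show ?thesis by (intro homogeneous_single) simp
  qed simp
qed

lemma meval_homogeneous_scale:
  assumes "homogeneous d f" shows "meval f (c *s v) = c ^ d * meval f v"
proof -
  have "monomial (c *s v) m = c ^ d * monomial v m" if "m \<in> Poly_Mapping.keys f" for m
  proof -
    have "monomial (c *s v) m = c ^ (\<Sum>i\<in>UNIV. Poly_Mapping.lookup m i) * monomial v m"
      by (simp add: monomial_def power_mult_distrib prod.distrib power_sum)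
    then show ?thesis using that assms by (simp add: homogeneous_def)
  qed
  then show ?thesis
    by (simp add: meval_keys sum_distrib_left algebra_simps)
qed

lemma meval_homogeneous_0:
  assumes "homogeneous 0 f" shows "meval f v = meval f 0"
proof -
  have "monomial v m = monomial 0 m" if "m \<in> Poly_Mapping.keys f" for m
    using that assms by (simp add: homogeneous_def monomial_def)
  then show ?thesis
    by (simp add: meval_keys)
qed

lemma euler_identity:
  assumes "homogeneous d f"
  shows "(\<Sum>i\<in>UNIV. v $ i * meval (mderiv i f) v) = of_nat d * meval f v"
proof -
  have mono: "v $ i * (of_nat (Poly_Mapping.lookup m i) * c * monomial v (m - Poly_Mapping.single i 1)) =
      of_nat (Poly_Mapping.lookup m i) * (c * monomial v m)" for m i c
  proof (cases "Poly_Mapping.lookup m i = 0")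
    case False
    have "monomial v m = v $ i * monomial v (m - Poly_Mapping.single i 1)"
      using single_plus_minus[OF False] monomial_add[of v "Poly_Mapping.single i 1"]
      by (metis monomial_single power_one_right)
    then show ?thesis by (simp add: algebra_simps)
  qed simp
  have "(\<Sum>i\<in>UNIV. v $ i * meval (mderiv i f) v) =
      (\<Sum>i\<in>UNIV. \<Sum>m\<in>Poly_Mapping.keys f. of_nat (Poly_Mapping.lookup m i) *
        (Poly_Mapping.lookup f m * monomial v m))"
    by (simp only: mderiv_def meval_sum meval_single sum_distrib_left mono)
  also have "\<dots> = (\<Sum>m\<in>Poly_Mapping.keys f. of_nat (\<Sum>i\<in>UNIV. Poly_Mapping.lookup m i) *
        (Poly_Mapping.lookup f m * monomial v m))"
    by (subst sum.swap) (simp add: sum_distrib_right)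
  also have "\<dots> = (\<Sum>m\<in>Poly_Mapping.keys f. of_nat d * (Poly_Mapping.lookup f m * monomial v m))"
    using assms by (intro sum.cong) (auto simp: homogeneous_def)
  finally show ?thesis
    by (simp add: meval_keys sum_distrib_left)
qed

text \<open>A cubic form is encoded by the commutative bilinear product for which \<open>dot (x \<star> y) z\<close> is its
  polarization; the last axiom makes this trilinear form symmetric in all three arguments.\<close>

locale cubic_product =
  fixes mul :: "'a::field_char_0 ^ 'n::finite \<Rightarrow> 'a ^ 'n \<Rightarrow> 'a ^ 'n"  (infixl "\<star>" 75)
  assumes mul_add_left: "(x + y) \<star> z = x \<star> z + y \<star> z"
    and mul_scale_left: "(c *s x) \<star> z = c *s (x \<star> z)"
    and mul_commute: "x \<star> y = y \<star> x"
    and dot_mul_commute: "dot (x \<star> y) z = dot (x \<star> z) y"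

text \<open>Iterating Euler's identity expresses a cubic form and its first and second derivatives by the
  constant third derivatives.\<close>

lemma cubic_form_polarization:
  fixes f :: "('n::finite, 'a::field_char_0) mpol"
  assumes f: "homogeneous 3 f"
  obtains mul :: "'a ^ 'n \<Rightarrow> 'a ^ 'n \<Rightarrow> 'a ^ 'n" where
    "cubic_product mul"
    "\<And>v. meval f v = dot (mul v v) v"
    "\<And>i v. meval (mderiv i f) v = 3 * mul v v $ i"
    "\<And>i j v. meval (mderiv i (mderiv j f)) v = 6 * mul v (axis i 1) $ j"
proof -
  define c where "c i j k = meval (mderiv i (mderiv j (mderiv k f))) 0" for i j k
  have c1: "c i j k = c j i k" for i j k by (simp add: c_def mderiv_commute)
  have c2: "c i j k = c i k j" for i j k by (simp add: c_def mderiv_commute)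
  define mul :: "'a ^ 'n \<Rightarrow> 'a ^ 'n \<Rightarrow> 'a ^ 'n"
    where "mul x y = (\<chi> k. (\<Sum>i\<in>UNIV. \<Sum>j\<in>UNIV. x $ i * (y $ j * c i j k)) / 6)" for x y
  have h1: "homogeneous 2 (mderiv k f)" for k using homogeneous_mderiv[OF f, of k] by simp
  have h2: "homogeneous 1 (mderiv j (mderiv k f))" for j k using homogeneous_mderiv[OF h1, of j k] by simp
  have h3: "homogeneous 0 (mderiv i (mderiv j (mderiv k f)))" for i j k
    using homogeneous_mderiv[OF h2, of i j k] by simp
  have e2: "meval (mderiv j (mderiv k f)) v = (\<Sum>i\<in>UNIV. v $ i * c i j k)" for j k v
    using euler_identity[OF h2, of v j k] meval_homogeneous_0[OF h3, of _ _ _ v] by (simp add: c_def)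
  have e1: "2 * meval (mderiv k f) v = (\<Sum>j\<in>UNIV. \<Sum>i\<in>UNIV. v $ j * (v $ i * c i j k))" for k v
    using euler_identity[OF h1, of v k] by (simp add: e2 sum_distrib_left)
  have e1': "meval (mderiv k f) v = 3 * mul v v $ k" for k v
    using e1[of k v] c1 by (simp add: mul_def) (metis (lifting) sum.cong mult.commute)
  have "3 * meval f v = 3 * dot (mul v v) v" for v
    using euler_identity[OF f, of v]
    by (simp add: e1' dot_def sum_distrib_left mult_ac)
  then have e0: "meval f v = dot (mul v v) v" for v by simp
  have e2': "meval (mderiv i (mderiv j f)) v = 6 * mul v (axis i 1) $ j" for i j v
    by (simp add: e2 mul_def axis_def if_distrib[where f="\<lambda>x. x * _"]
        if_distrib[where f="\<lambda>x. v $ _ * x"] cong: if_cong)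
  have "cubic_product mul"
  proof
    fix x y z :: "'a ^ 'n" and t :: 'a
    show "mul (x + y) z = mul x z + mul y z"
      by (simp add: mul_def vec_eq_iff sum.distrib algebra_simps add_divide_distrib)
    show "mul (t *s x) z = t *s mul x z"
      by (simp add: mul_def vec_eq_iff sum_distrib_left mult_ac)
    show "mul x y = mul y x"
      unfolding mul_def vec_eq_iff
      using c1 by (subst sum.swap) (simp add: mult_ac)
    have d: "6 * dot (mul x y) z = (\<Sum>i\<in>UNIV. \<Sum>k\<in>UNIV. \<Sum>j\<in>UNIV. x $ i * (y $ j * (z $ k * c i j k)))"
      for y z :: "'a ^ 'n"
      by (subst sum.swap) (simp add: dot_def mul_def sum_distrib_left sum_distrib_right mult_ac
          sum_divide_distrib)
    have "6 * dot (mul x y) z = 6 * dot (mul x z) y"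
    proof -
      have eq: "x $ i * (y $ j * (z $ k * c i j k)) = x $ i * (z $ k * (y $ j * c i k j))" for i j k
        by (simp add: c2[of i j k] mult_ac)
      show ?thesis
        unfolding d by (rule sum.cong[OF refl], subst sum.swap) (simp add: eq)
    qed
    then show "dot (mul x y) z = dot (mul x z) y" by simp
  qed
  from that[OF this e0 e1' e2'] show thesis .
qed

section \<open>Cubic forms with vanishing Hessian\<close>

context cubic_product
begin

lemma mul_add_right: "z \<star> (x + y) = z \<star> x + z \<star> y"
  by (metis mul_add_left mul_commute)

lemma mul_scale_right: "z \<star> (c *s x) = c *s (z \<star> x)"
  by (metis mul_scale_left mul_commute)

lemma mul_zero_left [simp]: "0 \<star> y = 0"
  using mul_scale_left[of 0 0 y] by simp

lemmas mul_simps = mul_add_left mul_add_right mul_scale_left mul_scale_right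

lemma mul_diff_right: "z \<star> (x - y) = z \<star> x - z \<star> y"
  using mul_add_right[of z "x - y" y] by (simp add: algebra_simps)

text \<open>The part of \<open>f (x + y)\<close> that is odd in \<open>y\<close> determines the gradient at \<open>x\<close>.\<close>

lemma cubic_odd_part:
  "dot ((x + y) \<star> (x + y)) (x + y) - dot ((x - y) \<star> (x - y)) (x - y) - 2 * dot (y \<star> y) y
     = 6 * dot (x \<star> x) y"
proof -
  have "x - y = x + (-1) *s y" by simp
  moreover have "dot ((x + y) \<star> (x + y)) (x + y)
        - dot ((x + (-1) *s y) \<star> (x + (-1) *s y)) (x + (-1) *s y) - 2 * dot (y \<star> y) y = 6 * dot (x \<star> x) y"
    using dot_mul_commute[of x x y] dot_mul_commute[of x y x] dot_mul_commute[of y x x]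
    unfolding mul_simps dot_simps mul_commute[of y x] by (simp add: algebra_simps)
  ultimately show ?thesis by (simp only:)
qed

definition mul_matrix :: "'a ^ 'n \<Rightarrow> 'a ^ 'n ^ 'n" where
  "mul_matrix x = matrix (\<lambda>y. x \<star> y)"

lemma mul_matrix_works: "mul_matrix x *v y = x \<star> y"
  unfolding mul_matrix_def by (rule matrix_works) (intro linear_vecI mul_simps)

lemma range_mul_matrix: "range ((*v) (mul_matrix x)) = range ((\<star>) x)"
  by (simp add: mul_matrix_works)

lemma mul_matrix_entry: "mul_matrix x $ i $ j = (x \<star> axis j 1) $ i"
  by (simp add: mul_matrix_def matrix_def)

lemma mul_matrix_line: "mul_matrix (x + t *s w) = mul_matrix x + (\<chi> i j. t * mul_matrix w $ i $ j)"
  by (simp add: vec_eq_iff mul_matrix_entry mul_simps)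

lemma line_poly_mul: "line_poly (\<lambda>x. (x \<star> y) $ i)"
  unfolding line_poly_def
proof (intro allI)
  fix x w
  show "\<exists>p. \<forall>t. ((x + t *s w) \<star> y) $ i = poly p t"
    by (intro exI[of _ "[:(x \<star> y) $ i, (w \<star> y) $ i:]"]) (simp add: mul_simps)
qed

lemma line_poly_cubic: "line_poly (\<lambda>x. dot (x \<star> x) x)"
  unfolding line_poly_def
proof (intro allI)
  fix x w
  show "\<exists>p. \<forall>t. dot ((x + t *s w) \<star> (x + t *s w)) (x + t *s w) = poly p t"
    by (intro exI[of _ "[:dot (x \<star> x) x, dot (x \<star> x) w + dot (x \<star> w) x + dot (w \<star> x) x,
        dot (x \<star> w) w + dot (w \<star> x) w + dot (w \<star> w) x, dot (w \<star> w) w:]"])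
      (simp add: mul_simps dot_simps algebra_simps)
qed

text \<open>The operator \<open>(\<star>) x\<close>, hence the Hessian matrix at \<open>x\<close>, has the largest rank that occurs.\<close>

definition max_rank :: "'a ^ 'n \<Rightarrow> bool" where
  "max_rank x \<longleftrightarrow> (\<forall>z. vec.dim (range ((\<star>) z)) \<le> vec.dim (range ((\<star>) x)))"

lemma max_rank_range_persists:
  assumes "max_rank x" and u: "\<And>t. t \<noteq> 0 \<Longrightarrow> u \<in> range ((\<star>) (x + t *s w))"
  shows "u \<in> range ((\<star>) x)"
proof -
  have "u \<in> range ((*v) (mul_matrix x))"
  proof (rule range_persists_at_maximal_rank[where B = "mul_matrix w"])
    show "vec.dim (range ((*v) (mul_matrix x + (\<chi> i j. t * mul_matrix w $ i $ j))))
        \<le> vec.dim (range ((*v) (mul_matrix x)))" for t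
      unfolding mul_matrix_line[symmetric] range_mul_matrix using assms(1) max_rank_def by blast
    show "u \<in> range ((*v) (mul_matrix x + (\<chi> i j. t * mul_matrix w $ i $ j)))" if "t \<noteq> 0" for t
      unfolding mul_matrix_line[symmetric] range_mul_matrix by (rule u[OF that])
  qed
  then show ?thesis by (simp add: range_mul_matrix)
qed

text \<open>First and second order consequences of the persistence of the range along a line through a
  point of maximal rank, applied to a kernel vector.\<close>

lemma kernel_range_subset:
  assumes "max_rank x" "x \<star> y = 0"
  obtains z where "w \<star> y = x \<star> z"
proof -
  have "w \<star> y \<in> range ((\<star>) (x + t *s w))" if "t \<noteq> 0" for t
    using that assms(2)
    by (intro image_eqI[of _ _ "(1 / t) *s y"]) (auto simp: mul_simps)
  from max_rank_range_persists[OF assms(1) this] that show thesis by blast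
qed

lemma kernel_lift_isotropic:
  assumes "max_rank x" "x \<star> y = 0" "w \<star> y = x \<star> z"
  shows "dot (x \<star> z) z = 0"
proof -
  have w: "w \<star> z \<in> range ((\<star>) (x + t *s w))" if "t \<noteq> 0" for t
  proof (rule image_eqI)
    \<comment> \<open>By the hypotheses, \<open>(x + t *s w) \<star> (y - t *s z) = - t\<^sup>2 *s (w \<star> z)\<close>.\<close>
    show "w \<star> z = (x + t *s w) \<star> ((1 / t) *s z - (1 / (t * t)) *s y)"
      using that assms(2,3) by (simp add: mul_simps mul_diff_right vec_eq_iff field_simps)
  qed simp
  obtain z' where z': "w \<star> z = x \<star> z'"
    using max_rank_range_persists[OF assms(1) w] by auto
  have "dot (x \<star> z) z = dot (w \<star> z) y"
    by (metis assms(3) dot_mul_commute)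
  also have "\<dots> = dot (x \<star> y) z'"
    by (simp add: z' dot_mul_commute)
  finally show ?thesis by (simp add: assms(2))
qed

text \<open>Linearization in \<open>w\<close>, as the lifts \<open>z1\<close>, \<open>z2\<close> of \<open>w1\<close>, \<open>w2\<close> add up to a lift of \<open>w1 + w2\<close>.\<close>

lemma kernel_lift_isotropic2:
  assumes x: "max_rank x" and y: "x \<star> y = 0"
    and z: "w1 \<star> y = x \<star> z1" "w2 \<star> y = x \<star> z2"
  shows "dot (x \<star> z1) z2 = 0"
proof -
  have "dot (x \<star> (z1 + z2)) (z1 + z2) = 0"
    using z by (intro kernel_lift_isotropic[OF x y, of "w1 + w2"]) (simp add: mul_simps)
  then have "dot (x \<star> z1) z2 + dot (x \<star> z2) z1 = 0"
    using kernel_lift_isotropic[OF x y z(1)] kernel_lift_isotropic[OF x y z(2)]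
    by (simp add: mul_simps dot_simps add.commute)
  then show ?thesis
    using dot_mul_commute[of x z2 z1] by simp
qed

end

text \<open>The nondegeneracy condition says that no directional derivative of the cubic form vanishes, the
  second condition that its Hessian matrix is everywhere singular.\<close>

locale degenerate_hessian = cubic_product mul
  for mul :: "'a::{alg_closed_field, field_char_0} ^ 'n::finite \<Rightarrow> 'a ^ 'n \<Rightarrow> 'a ^ 'n"  (infixl "\<star>" 75) +
  assumes nondegenerate: "(\<And>w. w \<star> y = 0) \<Longrightarrow> y = 0"
    and singular: "\<exists>y. y \<noteq> 0 \<and> x \<star> y = 0"
begin

lemma mul_nonzero: "y \<noteq> 0 \<Longrightarrow> \<exists>w i. (w \<star> y) $ i \<noteq> 0"
  using nondegenerate[of y] by (auto simp: vec_eq_iff)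

lemma cubic_nonzero: "\<exists>x. dot (x \<star> x) x \<noteq> 0"
proof (rule ccontr)
  assume "\<not> ?thesis"
  then have 0: "dot (x \<star> x) x = 0" for x by simp
  have "dot (x \<star> x) y = 0" for x y
  proof -
    have "6 * dot (x \<star> x) y = 0"
      unfolding cubic_odd_part[symmetric] 0 by simp
    then show ?thesis by simp
  qed
  then have sq: "x \<star> x = 0" for x by (intro dot_eqI) simp
  have "x \<star> y = 0" for x y
  proof -
    have "2 *s (x \<star> y) = (x + y) \<star> (x + y)"
      using mul_commute[of x y] sq by (simp add: mul_simps vec_eq_iff)
    then have "2 *s (x \<star> y) = 0" by (simp only: sq)
    then show ?thesis by (simp add: vec_eq_iff)
  qed
  then have "y = 0" for y :: "'a ^ 'n" using nondegenerate by blast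
  then show False using singular by blast
qed

text \<open>Points at which the Hessian matrix has the largest rank and which do not lie on the cubic.\<close>

definition generic :: "'a ^ 'n \<Rightarrow> bool" where
  "generic x \<longleftrightarrow> max_rank x \<and> dot (x \<star> x) x \<noteq> 0"

text \<open>There is a generic point at which two given nonzero vectors are not in the kernel: the conditions are
  implied by the nonvanishing of functions that are polynomial on lines. For the rank this function is
  \<open>det (mul_matrix x + N)\<close>, where \<open>N\<close> is complementary at one point of largest rank.\<close>

lemma generic_avoiding:
  assumes "y1 \<noteq> 0" "y2 \<noteq> 0"
  obtains x where "generic x" "x \<star> y1 \<noteq> 0" "x \<star> y2 \<noteq> 0"
proof -
  let ?r = "\<lambda>z. vec.dim (range ((\<star>) z))"
  have "?r z \<le> CARD('n)" for z
    using vec.dim_subset_UNIV[of "range ((\<star>) z)"] by (simp add: vec.dimension_def card_cart_basis)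
  then have fin: "finite (range ?r)"
    by (intro finite_subset[OF _ finite_atMost[of "CARD('n)"]] image_subsetI) simp
  then have "Max (range ?r) \<in> range ?r" by (rule Max_in) simp
  then obtain x0 where "Max (range ?r) = ?r x0" by (rule imageE)
  then have x0: "?r z \<le> ?r x0" for z
    using Max_ge[OF fin, of "?r z"] by simp
  have "\<not> surj ((*v) (mul_matrix x0))"
  proof
    assume "surj ((*v) (mul_matrix x0))"
    then have "invertible (mul_matrix x0)"
      unfolding invertible_right_inverse matrix_right_invertible_surjective .
    then have "\<forall>y. mul_matrix x0 *v y = 0 \<longrightarrow> y = 0"
      unfolding invertible_left_inverse matrix_left_invertible_ker .
    then show False using singular[of x0] unfolding mul_matrix_works by blast
  qed
  then obtain u where "u \<notin> range ((*v) (mul_matrix x0))" by auto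
  then obtain N where N: "vec.dim (range ((*v) N)) + ?r x0 \<le> CARD('n)" "invertible (mul_matrix x0 + N)"
    by (rule complementary_matrix) (simp add: range_mul_matrix)
  let ?g = "\<lambda>x. det (mul_matrix x + N)"
  have max: "max_rank x" if "?g x \<noteq> 0" for x
  proof -
    have surj: "surj ((*v) (mul_matrix x + N))"
      using that unfolding invertible_det_nz[symmetric] invertible_right_inverse
        matrix_right_invertible_surjective .
    have "\<exists>a\<in>range ((\<star>) x). \<exists>b\<in>range ((*v) N). v = a + b" for v
    proof -
      obtain z where "v = (mul_matrix x + N) *v z" using surj by (auto simp: surj_def)
      then have "v = x \<star> z + N *v z"
        by (simp only: matrix_vector_mult_add_rdistrib mul_matrix_works)
      then show ?thesis by blast
    qed
    then have "CARD('n) \<le> ?r x + vec.dim (range ((*v) N))" using dim_sums_UNIV[of _ _ "{}"]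
      by (metis add.right_neutral card.empty empty_subsetI vec.independent_empty)
    then have "?r x0 \<le> ?r x" using N(1) by linarith
    then show ?thesis unfolding max_rank_def using x0 order_trans by blast
  qed
  obtain w1 i1 where w1: "(w1 \<star> y1) $ i1 \<noteq> 0" using mul_nonzero assms by blast
  obtain w2 i2 where w2: "(w2 \<star> y2) $ i2 \<noteq> 0" using mul_nonzero assms by blast
  obtain c where c: "dot (c \<star> c) c \<noteq> 0" using cubic_nonzero by blast
  have g: "line_poly ?g"
  proof (rule line_poly_det)
    show "line_poly (\<lambda>x. (mul_matrix x + N) $ i $ j)" for i j
      by (simp add: mul_matrix_entry) (intro line_poly_add line_poly_mul line_poly_const)
  qed
  have g0: "?g x0 \<noteq> 0" using N(2) by (simp add: invertible_det_nz)
  let ?h1 = "\<lambda>x. (x \<star> y1) $ i1" and ?h2 = "\<lambda>x. (x \<star> y2) $ i2" and ?f = "\<lambda>x. dot (x \<star> x) x"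
  obtain a where a: "?g a * ?f a \<noteq> 0"
    using line_poly_generic[OF g line_poly_cubic g0 c] by auto
  obtain b where b: "?h1 b * ?h2 b \<noteq> 0"
    using line_poly_generic[of ?h1 ?h2, OF line_poly_mul line_poly_mul w1 w2] by auto
  obtain x where x: "?g x * ?f x \<noteq> 0" "?h1 x * ?h2 x \<noteq> 0"
    by (rule line_poly_generic[OF line_poly_mult[OF g line_poly_cubic]
          line_poly_mult[OF line_poly_mul line_poly_mul] a b])
  have "x \<star> y1 \<noteq> 0" "x \<star> y2 \<noteq> 0" using x(2) by auto
  moreover have "generic x" using x(1) max[of x] by (simp add: generic_def)
  ultimately show thesis using that by blast
qed

end

locale degenerate_hessian5 = degenerate_hessian mul
  for mul :: "'a::{alg_closed_field, field_char_0} ^ 5 \<Rightarrow> 'a ^ 5 \<Rightarrow> 'a ^ 5"  (infixl "\<star>" 75)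
begin

text \<open>The heart of the argument: for a kernel vector \<open>y\<close> of the Hessian at a generic point \<open>x\<close>, the
  operator \<open>(\<star>) y\<close> has rank one. Otherwise two independent functionals in the range of \<open>(\<star>) y\<close> would vanish on four
  independent vectors of the five-dimensional space.\<close>

lemma generic_kernel_rank_one:
  assumes x: "generic x" and y: "y \<noteq> 0" "x \<star> y = 0"
  obtains l where "l \<noteq> 0" "\<And>w. y \<star> w = dot l w *s l" "dot l y = 0"
proof -
  have m: "max_rank x" and fx: "dot (x \<star> x) x \<noteq> 0" using x by (auto simp: generic_def)
  have kx: "dot (w \<star> y) x = 0" for w
    by (metis dot_mul_commute dot_zero_left mul_commute y(2))
  have ky: "dot (w \<star> y) y = 0" for w
  proof -
    obtain z where "w \<star> y = x \<star> z" by (rule kernel_range_subset[OF m y(2)])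
    then show ?thesis by (simp add: dot_mul_commute[of x z] y(2))
  qed
  obtain w1 i where "(w1 \<star> y) $ i \<noteq> 0" using mul_nonzero y by blast
  then have i1: "w1 \<star> y \<noteq> 0" by auto
  have "w2 \<star> y \<in> vec.span {w1 \<star> y}" for w2
  proof (rule ccontr)
    assume i2: "w2 \<star> y \<notin> vec.span {w1 \<star> y}"
    obtain z1 where z1: "w1 \<star> y = x \<star> z1" by (rule kernel_range_subset[OF m y(2)])
    obtain z2 where z2: "w2 \<star> y = x \<star> z2" by (rule kernel_range_subset[OF m y(2)])
    let ?J = "{w2 \<star> y, w1 \<star> y}" and ?S = "{x, z2, z1, y}"
    have J: "vec.independent ?J"
      using i1 i2 by (intro vec.independent_insertI vec.independent_empty) auto
    have J2: "w2 \<star> y \<noteq> w1 \<star> y" using i2 vec.span_base[of "w1 \<star> y" "{w1 \<star> y}"] by auto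
    \<comment> \<open>The lifts \<open>z1\<close>, \<open>z2\<close> are independent of \<open>y\<close> because \<open>(\<star>) x\<close> kills \<open>y\<close> and maps them
      to independent vectors, and \<open>x\<close> is independent of all
      three because \<open>f x \<noteq> 0\<close>.\<close>
    have n1: "z1 \<notin> vec.span {y}"
    proof
      assume "z1 \<in> vec.span {y}"
      then obtain k where "z1 = k *s y" by (auto simp: vec.span_singleton)
      then show False using z1 i1 y(2) by (simp add: mul_simps)
    qed
    have n2: "z2 \<notin> vec.span {z1, y}"
    proof
      assume "z2 \<in> vec.span {z1, y}"
      then obtain a b where "z2 - a *s z1 = b *s y"
        by (auto simp: vec.span_breakdown_eq vec.span_singleton)
      then have "z2 = a *s z1 + b *s y" by (simp add: algebra_simps)
      then have "w2 \<star> y = a *s (w1 \<star> y)" using z1 z2 y(2) by (simp add: mul_simps)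
      then show False using i2 by (auto simp: vec.span_singleton)
    qed
    have n3: "x \<notin> vec.span {z2, z1, y}"
    proof
      assume "x \<in> vec.span {z2, z1, y}"
      then obtain a b c where "x - a *s z2 - b *s z1 = c *s y"
        by (auto simp: vec.span_breakdown_eq vec.span_singleton)
      then have "x = a *s z2 + b *s z1 + c *s y" by (simp add: algebra_simps)
      then have "x \<star> x = x \<star> (a *s z2 + b *s z1 + c *s y)" by (rule arg_cong)
      then have "x \<star> x = a *s (w2 \<star> y) + b *s (w1 \<star> y)" using z1 z2 y(2) by (simp add: mul_simps)
      then show False using fx kx by (simp add: dot_simps)
    qed
    have S: "vec.independent ?S"
      using n1 n2 n3 y(1) by (intro vec.independent_insertI vec.independent_empty) auto
    have "z1 \<noteq> y" "z2 \<notin> {z1, y}" "x \<notin> {z2, z1, y}"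
      using n1 n2 n3 vec.span_superset[of "{y}"] vec.span_superset[of "{z1, y}"]
        vec.span_superset[of "{z2, z1, y}"] by blast+
    then have "card ?S = 4"
      by simp
    moreover have "dot i s = 0" if "i \<in> ?J" "s \<in> ?S" for i s
      using that kx[of w1] kx[of w2] ky[of w1] ky[of w2] kernel_lift_isotropic2[OF m y(2)] z1 z2
      by auto
    ultimately show False
      using card_annihilator_le[OF J S] J2 by simp
  qed
  then have "\<exists>k. w \<star> y = k *s (w1 \<star> y)" for w by (auto simp: vec.span_singleton)
  then obtain k where k: "\<And>w. w \<star> y = k w *s (w1 \<star> y)" by metis
  let ?i = "w1 \<star> y"
  obtain j where j: "?i $ j \<noteq> 0" using i1 by (auto simp: vec_eq_iff)
  let ?v = "(1 / ?i $ j) *s axis j 1"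
  have v: "dot ?i ?v = 1" using j by (simp add: dot_simps dot_axis)
  define c where "c = k ?v"
  \<comment> \<open>Symmetry of the form of rank one determines the factor.\<close>
  have kc: "k w = c * dot ?i w" for w
  proof -
    have "k w * dot ?i ?v = dot (w \<star> y) ?v" by (simp add: k[of w] dot_simps)
    also have "\<dots> = dot (?v \<star> y) w" by (metis dot_mul_commute mul_commute)
    also have "\<dots> = c * dot ?i w" by (simp add: k[of ?v] dot_simps c_def)
    finally show ?thesis by (simp add: v)
  qed
  obtain s where s: "s ^ 2 = c" using nth_root_exists[of 2 c] by auto
  have main: "y \<star> w = dot (s *s ?i) w *s (s *s ?i)" for w
    by (subst mul_commute, subst k) (simp add: kc dot_simps s[symmetric] power2_eq_square mult_ac)
  have "c \<noteq> 0" using i1 k[of w1] kc[of w1] by auto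
  then have "s *s ?i \<noteq> 0" using s i1 by auto
  moreover have "dot (s *s ?i) y = 0" by (simp add: dot_simps ky)
  ultimately show thesis using that main by blast
qed

text \<open>The derivative of the cubic form in the direction \<open>y\<close> is three times the square of the linear form
  \<open>l\<close>, which vanishes at \<open>y\<close>.\<close>

definition rank_one_vertex :: "'a ^ 5 \<Rightarrow> 'a ^ 5 \<Rightarrow> bool" where
  "rank_one_vertex y l \<longleftrightarrow> y \<noteq> 0 \<and> l \<noteq> 0 \<and> (\<forall>w. y \<star> w = dot l w *s l) \<and> dot l y = 0"

lemma rank_one_vertex_avoiding:
  assumes "rank_one_vertex y1 l1" "rank_one_vertex y2 l2"
  obtains y l where "rank_one_vertex y l" "l \<notin> vec.span {l1}" "l \<notin> vec.span {l2}"
proof -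
  obtain x where x: "generic x" "x \<star> y1 \<noteq> 0" "x \<star> y2 \<noteq> 0"
    using generic_avoiding assms unfolding rank_one_vertex_def by blast
  obtain y where y: "y \<noteq> 0" "x \<star> y = 0" using singular by blast
  obtain l where l: "l \<noteq> 0" "\<And>w. y \<star> w = dot l w *s l" "dot l y = 0"
    using generic_kernel_rank_one[OF x(1) y] by metis
  have "l \<notin> vec.span {l'}" if v: "rank_one_vertex y' l'" "x \<star> y' \<noteq> 0" for y' l'
  proof
    assume "l \<in> vec.span {l'}"
    then obtain k where k: "l = k *s l'" by (auto simp: vec.span_singleton)
    have "k \<noteq> 0" using k l(1) by auto
    have "w \<star> (y - k ^ 2 *s y') = 0" for w
    proof -
      have "w \<star> y = k ^ 2 *s (w \<star> y')"
        using v(1) mul_commute[of w]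
        by (simp add: l(2) k rank_one_vertex_def dot_simps power2_eq_square mult_ac)
      then show ?thesis by (simp add: mul_diff_right mul_scale_right)
    qed
    then have "y - k ^ 2 *s y' = 0" by (rule nondegenerate)
    then have "k ^ 2 *s (x \<star> y') = 0" using y(2) by (simp add: mul_scale_right)
    then show False using \<open>k \<noteq> 0\<close> v(2) by simp
  qed
  with assms x l y show thesis
    by (intro that[of y l]) (auto simp: rank_one_vertex_def)
qed

text \<open>The two expressions of \<open>y \<star> y'\<close> as a multiple of \<open>l\<close> and of \<open>l'\<close> coincide.\<close>

lemma rank_one_vertex_orthogonal:
  assumes "rank_one_vertex y l" "rank_one_vertex y' l'"
  shows "dot l y' = 0"
proof (rule ccontr)
  assume n: "dot l y' \<noteq> 0"
  have "dot l y' *s l = dot l' y *s l'"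
    using assms mul_commute[of y y'] by (simp add: rank_one_vertex_def)
  then have "dot l y' * dot l y' = dot l' y * dot l' y'"
    by (metis dot_scale_left)
  then show False using assms(2) n by (simp add: rank_one_vertex_def)
qed

text \<open>Three pairwise independent squares among the derivatives of the cubic involve only two linear forms,
  for otherwise three independent functionals would vanish on three independent vectors. Hence the
  derivatives in suitable directions \<open>e0\<close>, \<open>e1\<close>, \<open>e2\<close> are \<open>l\<^sup>2\<close>, \<open>2 * l * m\<close> and \<open>m\<^sup>2\<close> up to a common factor.\<close>

lemma polar_net:
  obtains e0 e1 e2 l m where
    "\<And>w. e0 \<star> w = dot l w *s l" "\<And>w. e2 \<star> w = dot m w *s m"
    "\<And>w. e1 \<star> w = dot l w *s m + dot m w *s l"
    "\<And>e. e \<in> {e0, e1, e2} \<Longrightarrow> dot l e = 0 \<and> dot m e = 0"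
    "vec.independent {l, m}" "l \<noteq> m"
proof -
  obtain v :: "'a ^ 5" where "v \<noteq> 0" using singular by blast
  then obtain x where "generic x" using generic_avoiding by blast
  moreover obtain y where "y \<noteq> 0" "x \<star> y = 0" using singular by blast
  ultimately obtain y1 l1 where v1: "rank_one_vertex y1 l1"
    by (metis generic_kernel_rank_one rank_one_vertex_def)
  obtain y2 l2 where v2: "rank_one_vertex y2 l2" "l2 \<notin> vec.span {l1}"
    using rank_one_vertex_avoiding[OF v1 v1] by blast
  obtain y3 l3 where v3: "rank_one_vertex y3 l3" "l3 \<notin> vec.span {l1}" "l3 \<notin> vec.span {l2}"
    using rank_one_vertex_avoiding[OF v1 v2(1)] by blast
  note vs = v1 v2(1) v3(1)
  note v = vs[unfolded rank_one_vertex_def]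
  have l12: "vec.independent {l2, l1}"
    using v v2(2) by (intro vec.independent_insertI vec.independent_empty) auto
  have "l3 \<in> vec.span {l2, l1}"
  proof (rule ccontr)
    assume l3: "l3 \<notin> vec.span {l2, l1}"
    have J: "vec.independent {l3, l2, l1}" using l3 l12 by (rule vec.independent_insertI)
    have n2: "y2 \<notin> vec.span {y1}"
    proof
      assume "y2 \<in> vec.span {y1}"
      then obtain k where k: "y2 = k *s y1" by (auto simp: vec.span_singleton)
      obtain w where w: "dot l2 w = 1"
        using independent_functionals_solvable[of "{l2}" "\<lambda>_. 1"] v by auto
      have "l2 = y2 \<star> w" using v w by simp
      also have "\<dots> = (k * dot l1 w) *s l1" using v by (simp add: k mul_simps)
      finally show False using v2(2) by (auto simp: vec.span_singleton)
    qed
    have n3: "y3 \<notin> vec.span {y2, y1}"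
    proof
      assume "y3 \<in> vec.span {y2, y1}"
      then obtain a b where "y3 - a *s y2 = b *s y1"
        by (auto simp: vec.span_breakdown_eq vec.span_singleton)
      then have k: "y3 = a *s y2 + b *s y1" by (simp add: algebra_simps)
      obtain w where w: "dot l3 w = 1"
        using independent_functionals_solvable[of "{l3}" "\<lambda>_. 1"] v by auto
      have "l3 = y3 \<star> w" using v w by simp
      also have "\<dots> = (a * dot l2 w) *s l2 + (b * dot l1 w) *s l1" using v by (simp add: k mul_simps)
      finally have "l3 - (a * dot l2 w) *s l2 = (b * dot l1 w) *s l1" by simp
      then show False using l3 by (auto simp: vec.span_breakdown_eq vec.span_singleton)
    qed
    have S: "vec.independent {y3, y2, y1}"
      using v n2 n3 by (intro vec.independent_insertI vec.independent_empty) auto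
    have "y2 \<noteq> y1" "y3 \<notin> {y2, y1}"
      using n2 n3 vec.span_superset[of "{y1}"] vec.span_superset[of "{y2, y1}"] by blast+
    moreover have "l2 \<noteq> l1" "l3 \<notin> {l2, l1}"
      using v2(2) l3 vec.span_superset[of "{l1}"] vec.span_superset[of "{l2, l1}"] by blast+
    moreover have "dot i s = 0" if "i \<in> {l3, l2, l1}" "s \<in> {y3, y2, y1}" for i s
      using that rank_one_vertex_orthogonal vs by auto
    ultimately show False using card_annihilator_le[OF J S] by simp
  qed
  then obtain a b where "l3 - b *s l2 = a *s l1"
    by (auto simp: vec.span_breakdown_eq vec.span_singleton)
  then have l3: "l3 = a *s l1 + b *s l2" by (simp add: algebra_simps)
  have a: "a \<noteq> 0" using v3(3) l3 by (auto simp: vec.span_singleton)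
  have b: "b \<noteq> 0" using v3(2) l3 by (auto simp: vec.span_singleton)
  \<comment> \<open>After rescaling, \<open>l3\<close> is the sum of the two other forms, and the mixed term \<open>2 * l * m\<close> is the
    difference of the square of the sum and the sum of the squares.\<close>
  let ?l = "a *s l1" and ?m = "b *s l2" and ?e0 = "a ^ 2 *s y1" and ?e2 = "b ^ 2 *s y2"
  have e0: "?e0 \<star> w = dot ?l w *s ?l" for w
    using v by (simp add: mul_simps dot_simps power2_eq_square mult_ac)
  have e2: "?e2 \<star> w = dot ?m w *s ?m" for w
    using v by (simp add: mul_simps dot_simps power2_eq_square mult_ac)
  have e1: "(y3 - ?e0 - ?e2) \<star> w = dot ?l w *s ?m + dot ?m w *s ?l" for w
  proof -
    have "(y3 - ?e0 - ?e2) \<star> w = y3 \<star> w - ?e0 \<star> w - ?e2 \<star> w"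
      by (simp add: mul_commute[of _ w] mul_diff_right)
    also have "y3 \<star> w = dot (?l + ?m) w *s (?l + ?m)" using v l3 by simp
    finally show ?thesis
      unfolding e0 e2 by (simp add: dot_simps vec_eq_iff algebra_simps)
  qed
  have orth: "dot l1 y = 0 \<and> dot l2 y = 0" if "y \<in> {y1, y2, y3}" for y
    using that rank_one_vertex_orthogonal vs by auto
  have "dot ?l e = 0 \<and> dot ?m e = 0" if "e \<in> {?e0, y3 - ?e0 - ?e2, ?e2}" for e
  proof -
    have diff: "dot u (p - q) = dot u p - dot u q" for u p q :: "'a ^ 5"
      using dot_add_right[of u "p - q" q] by simp
    show ?thesis using that orth by (auto simp: dot_simps diff)
  qed
  moreover have n: "?l \<notin> vec.span {?m}"
  proof
    assume "?l \<in> vec.span {?m}"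
    then obtain k where "a *s l1 = (k * b) *s l2" by (auto simp: vec.span_singleton)
    then have "(1 / a) *s (a *s l1) = (1 / a) *s ((k * b) *s l2)" by simp
    then have k: "l1 = (k * b / a) *s l2" using a by simp
    then have "k * b / a \<noteq> 0" using v by auto
    then have "l2 = (a / (k * b)) *s l1" by (subst k) auto
    then show False using v2(2) vec.span_singleton by blast
  qed
  moreover have "vec.independent {?l, ?m}"
    using n v b by (intro vec.independent_insertI vec.independent_empty) auto
  moreover have "?l \<noteq> ?m" using n vec.span_superset[of "{?m}"] by auto
  ultimately show thesis using that[OF e0 e2 e1] by metis
qed

end

section \<open>Coordinates\<close>

lemma UNIV_5: "(UNIV :: 5 set) = {0, 1, 2, 3, 4}"
proof -
  have "card {0, 1, 2, 3, 4 :: 5} = CARD(5)" by simp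
  then show ?thesis by (metis card_eq_UNIV_imp_eq_UNIV finite)
qed

lemma sum_5: "sum h (UNIV :: 5 set) = h 0 + h 1 + h 2 + h 3 + h 4"
  unfolding UNIV_5 by (simp add: ac_simps)

lemma forall_5: "(\<forall>i :: 5. P i) \<longleftrightarrow> P 0 \<and> P 1 \<and> P 2 \<and> P 3 \<and> P 4"
  using UNIV_5 by (metis UNIV_I empty_iff insert_iff)

lemma forall_2_0: "(\<forall>i :: 2. P i) \<longleftrightarrow> P 0 \<and> P 1"
proof -
  have "card {0, 1 :: 2} = CARD(2)" by simp
  then have "(UNIV :: 2 set) = {0, 1}" by (metis card_eq_UNIV_imp_eq_UNIV finite)
  then show ?thesis by (metis UNIV_I empty_iff insert_iff)
qed

lemma forall_3_0: "(\<forall>i :: 3. P i) \<longleftrightarrow> P 0 \<and> P 1 \<and> P 2"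
proof -
  have "card {0, 1, 2 :: 3} = CARD(3)" by simp
  then have "(UNIV :: 3 set) = {0, 1, 2}" by (metis card_eq_UNIV_imp_eq_UNIV finite)
  then show ?thesis by (metis UNIV_I empty_iff insert_iff)
qed

text \<open>The vector with the given coordinates at the indices 0 to 4; the index 0 coincides with 5 in the
  cyclic type of indices.\<close>

definition vec5 :: "'a \<Rightarrow> 'a \<Rightarrow> 'a \<Rightarrow> 'a \<Rightarrow> 'a \<Rightarrow> 'a ^ 5" where
  "vec5 a b c d e = (\<chi> i. if i = 0 then a else if i = 1 then b else if i = 2 then c
     else if i = 3 then d else e)"

lemma vec5_nth [simp]: "vec5 a b c d e $ 0 = a" "vec5 a b c d e $ 1 = b" "vec5 a b c d e $ 2 = c"
  "vec5 a b c d e $ 3 = d" "vec5 a b c d e $ 4 = e"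
  by (simp_all add: vec5_def)

lemma vec5_eq_iff: "x = (y :: 'a ^ 5) \<longleftrightarrow>
    x $ 0 = y $ 0 \<and> x $ 1 = y $ 1 \<and> x $ 2 = y $ 2 \<and> x $ 3 = y $ 3 \<and> x $ 4 = y $ 4"
  by (simp add: vec_eq_iff forall_5)

lemma dot_5: "dot (x :: 'a::comm_semiring_1 ^ 5) y =
    x $ 0 * y $ 0 + x $ 1 * y $ 1 + x $ 2 * y $ 2 + x $ 3 * y $ 3 + x $ 4 * y $ 4"
  by (simp add: dot_def sum_5)

section \<open>Normal form\<close>

text \<open>The cubic form of the normal form, known as the Perazzo cubic.\<close>

definition perazzo :: "'a::comm_ring_1 ^ 5 \<Rightarrow> 'a" where
  "perazzo x = x $ 0 * x $ 3 ^ 2 + 2 * x $ 1 * x $ 3 * x $ 4 + x $ 2 * x $ 4 ^ 2"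

text \<open>The gradient of the Perazzo cubic.\<close>

definition perazzo_grad :: "'a::comm_ring_1 ^ 5 \<Rightarrow> 'a ^ 5" where
  "perazzo_grad x = vec5 (x $ 3 ^ 2) (2 * x $ 3 * x $ 4) (x $ 4 ^ 2)
     (2 * (x $ 0 * x $ 3 + x $ 1 * x $ 4)) (2 * (x $ 1 * x $ 3 + x $ 2 * x $ 4))"

lemma perazzo_scale: "perazzo (c *s x) = c ^ 3 * perazzo x"
  by (simp add: perazzo_def algebra_simps power2_eq_square power3_eq_cube)

lemma perazzo_odd_part:
  "perazzo (x + y) - perazzo (x - y) - 2 * perazzo y = 2 * dot (perazzo_grad x) y"
  by (simp add: perazzo_def perazzo_grad_def dot_5 algebra_simps power2_eq_square)

context degenerate_hessian5
begin

lemma normal_form: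
  obtains E :: "'a ^ 5 ^ 5" where "invertible E"
    "\<And>c. dot ((E *v c) \<star> (E *v c)) (E *v c) = perazzo c"
proof -
  obtain e0 e1 e2 l m where e0: "\<And>w. e0 \<star> w = dot l w *s l" and e2: "\<And>w. e2 \<star> w = dot m w *s m"
    and e1: "\<And>w. e1 \<star> w = dot l w *s m + dot m w *s l"
    and orth: "\<And>e. e \<in> {e0, e1, e2} \<Longrightarrow> dot l e = 0 \<and> dot m e = 0"
    and lm: "vec.independent {l, m}" "l \<noteq> m"
    by (rule polar_net) blast
  obtain h3 where "\<And>i. i \<in> {l, m} \<Longrightarrow> dot i h3 = (if i = l then 1 else 0)"
    using independent_functionals_solvable[OF lm(1), of "\<lambda>i. if i = l then 1 else 0"] by blast
  then have h3: "dot l h3 = 1" "dot m h3 = 0" using lm(2) by auto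
  obtain h4 where "\<And>i. i \<in> {l, m} \<Longrightarrow> dot i h4 = (if i = m then 1 else 0)"
    using independent_functionals_solvable[OF lm(1), of "\<lambda>i. if i = m then 1 else 0"] by blast
  then have h4: "dot l h4 = 0" "dot m h4 = 1" using lm(2) by auto
  note orths = orth[of e0, simplified] orth[of e1, simplified] orth[of e2, simplified]
  note left = e0 e1 e2 e0[unfolded mul_commute[of e0]] e1[unfolded mul_commute[of e1]]
    e2[unfolded mul_commute[of e2]]
  \<comment> \<open>The shifts of \<open>h3\<close> and \<open>h4\<close> by \<open>e0\<close>, \<open>e1\<close>, \<open>e2\<close> that cancel the restriction of the cubic to their span.\<close>
  define a0 a1 b1 b2 where "a0 = - dot (h3 \<star> h3) h3 / 3" and "a1 = - dot (h3 \<star> h3) h4 / 2"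
    and "b1 = - dot (h3 \<star> h4) h4 / 2" and "b2 = - dot (h4 \<star> h4) h4 / 3"
  then have cub: "dot (h3 \<star> h3) h3 = - 3 * a0" "dot (h3 \<star> h3) h4 = - 2 * a1"
    "dot (h3 \<star> h4) h4 = - 2 * b1" "dot (h4 \<star> h4) h4 = - 3 * b2" by simp_all
  have cub': "dot (h3 \<star> h4) h3 = - 2 * a1" "dot (h4 \<star> h3) h3 = - 2 * a1"
    "dot (h4 \<star> h3) h4 = - 2 * b1" "dot (h4 \<star> h4) h3 = - 2 * b1"
    using cub dot_mul_commute[of h3 h4 h3] dot_mul_commute[of h4 h4 h3] mul_commute[of h4 h3] by auto
  \<comment> \<open>The factor 1/3 compensates the three positions of a vector \<open>e0\<close>, \<open>e1\<close>, \<open>e2\<close> in the trilinear form.\<close>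
  define h where "h c = (c $ 0 / 3 + a0 * c $ 3) *s e0 + (c $ 1 / 3 + a1 * c $ 3 + b1 * c $ 4) *s e1
      + (c $ 2 / 3 + b2 * c $ 4) *s e2 + c $ 3 *s h3 + c $ 4 *s h4" for c :: "'a ^ 5"
  have lin: "Vector_Spaces.linear (*s) (*s) h"
    by (intro linear_vecI) (simp_all add: h_def vec_eq_iff algebra_simps add_divide_distrib)
  define E where "E = matrix h"
  have Eh: "E *v c = h c" for c by (simp add: E_def matrix_works[OF lin])
  have val: "dot (h c \<star> h c) (h c) = perazzo c" for c
  proof -
    define x0 x1 x2 where "x0 = c $ 0 / 3 + a0 * c $ 3" and "x1 = c $ 1 / 3 + a1 * c $ 3 + b1 * c $ 4"
      and "x2 = c $ 2 / 3 + b2 * c $ 4"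
    define p u where "p = x0 *s e0 + x1 *s e1 + x2 *s e2" and "u = c $ 3 *s h3 + c $ 4 *s h4"
    have hc: "h c = p + u" by (simp add: h_def p_def u_def x0_def x1_def x2_def)
    have lu: "dot l u = c $ 3" "dot m u = c $ 4" by (simp_all add: u_def dot_simps h3 h4)
    have pw: "p \<star> w = (x0 * dot l w + x1 * dot m w) *s l + (x1 * dot l w + x2 * dot m w) *s m" for w
      by (simp add: p_def mul_simps left vec_eq_iff algebra_simps)
    have pp: "p \<star> p = 0" by (simp add: pw) (simp add: p_def dot_simps orths)
    have pu: "dot (p \<star> u) u = (x0 * c $ 3 + x1 * c $ 4) * c $ 3 + (x1 * c $ 3 + x2 * c $ 4) * c $ 4"
      by (simp add: pw dot_simps lu algebra_simps)
    have uu: "dot (u \<star> u) u = - 3 * a0 * c $ 3 ^ 3 - 6 * a1 * c $ 3 ^ 2 * c $ 4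
        - 6 * b1 * c $ 3 * c $ 4 ^ 2 - 3 * b2 * c $ 4 ^ 3"
      unfolding u_def mul_simps dot_simps cub cub'
      by (simp add: algebra_simps power2_eq_square power3_eq_cube)
    have "dot (h c \<star> h c) (h c) = 3 * dot (p \<star> u) u + dot (u \<star> u) u"
      using dot_mul_commute[of u p u] dot_mul_commute[of u u p] mul_commute[of u p]
        dot_mul_commute[of p u p]
      unfolding hc mul_add_left mul_add_right dot_add_left dot_add_right by (simp add: pp)
    also have "\<dots> = perazzo c"
      unfolding pu uu x0_def x1_def x2_def perazzo_def
      by (simp add: algebra_simps power2_eq_square power3_eq_cube)
    finally show ?thesis .
  qed
  have ker: "c = 0" if "h c = 0" for c
  proof -
    have l: "dot l (h c) = c $ 3" and m: "dot m (h c) = c $ 4"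
      by (simp_all add: h_def dot_simps orths h3 h4)
    then have c34: "c $ 3 = 0" "c $ 4 = 0" using that by auto
    have "dot (h c \<star> h3) h3 = c $ 0 / 3" "dot (h c \<star> h3) h4 = c $ 1 / 3"
      "dot (h c \<star> h4) h4 = c $ 2 / 3"
      by (simp_all add: h_def mul_simps dot_simps left h3 h4 c34)
    then show ?thesis using that c34 by (simp add: vec5_eq_iff)
  qed
  then have "invertible E"
    unfolding invertible_left_inverse matrix_left_invertible_ker Eh by blast
  with val that[of E] show thesis by (simp add: Eh)
qed

end

section \<open>Points of projective space\<close>

lemma mem_pt: "w \<in> pt v \<longleftrightarrow> (\<exists>c. w = c *s v)"
  by (auto simp: pt_def vec.span_singleton)

lemma self_mem_pt: "v \<in> pt v"
  by (simp add: pt_def vec.span_base)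

lemma pt_eqD: "pt v = pt w \<Longrightarrow> \<exists>c. v = c *s w"
  using self_mem_pt mem_pt by metis

lemma pt_eqD_nonzero:
  assumes "pt v = pt w" "v \<noteq> 0" obtains c where "c \<noteq> 0" "v = c *s w"
  using pt_eqD[OF assms(1)] assms(2) by (metis vec.scale_zero_left)

text \<open>A property that is invariant under scaling may be tested on any representative.\<close>

lemma pt_mem_Collect:
  assumes P: "\<And>c u. c \<noteq> 0 \<Longrightarrow> P u \<Longrightarrow> P (c *s u)"
  shows "pt v \<in> {pt u |u. u \<noteq> 0 \<and> P u} \<longleftrightarrow> v \<noteq> 0 \<and> P v"
proof
  assume "pt v \<in> {pt u |u. u \<noteq> 0 \<and> P u}"
  then obtain u where u: "pt u = pt v" "u \<noteq> 0" "P u" by auto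
  obtain c where c: "c \<noteq> 0" "u = c *s v" by (rule pt_eqD_nonzero[OF u(1,2)])
  then have "v = (1 / c) *s u" by simp
  then show "v \<noteq> 0 \<and> P v" using u c P[of "1 / c" u] by auto
qed auto

lemma image_pt: "(*v) A ` pt v = pt (A *v v)"
  unfolding pt_def using vec.linear_span_image[of "(*v) A" "{v}"] by simp

lemma proj_image_Collect:
  fixes A :: "'a::field ^ 'n ^ 'n::finite"
  assumes A: "invertible A"
  shows "proj_image A {pt v |v. v \<noteq> 0 \<and> P (A *v v)} = {pt w |w. w \<noteq> 0 \<and> P w}"
proof -
  obtain B where B: "A ** B = mat 1" "B ** A = mat 1" using A by (auto simp: invertible_def)
  have AB: "A *v (B *v w) = w" "B *v (A *v w) = w" for w
    by (simp_all add: matrix_vector_mul_assoc B)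
  have A0: "A *v v = 0 \<longleftrightarrow> v = 0" for v using AB by (metis matrix_vector_mult_0_right)
  show ?thesis
  proof (intro equalityI subsetI)
    fix p assume "p \<in> proj_image A {pt v |v. v \<noteq> 0 \<and> P (A *v v)}"
    then show "p \<in> {pt w |w. w \<noteq> 0 \<and> P w}"
      unfolding proj_image_def using image_pt A0 by fastforce
  next
    fix p assume "p \<in> {pt w |w. w \<noteq> 0 \<and> P w}"
    then obtain w where w: "p = pt w" "w \<noteq> 0" "P w" by auto
    then have "pt (B *v w) \<in> {pt v |v. v \<noteq> 0 \<and> P (A *v v)}" "p = (*v) A ` pt (B *v w)"
      using A0[of "B *v w"] by (auto simp: image_pt AB)
    then show "p \<in> proj_image A {pt v |v. v \<noteq> 0 \<and> P (A *v v)}"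
      unfolding proj_image_def by blast
  qed
qed

text \<open>A vector that annihilates everything would be a vertex: the form does not change along its direction.\<close>

lemma nondegenerate_if_not_cone:
  fixes f :: "('n::finite, 'a::field_char_0) mpol"
  assumes mul: "cubic_product mul" "\<And>v. meval f v = dot (mul v v) v"
    and cone: "\<not> is_cone (proj_zeros {f})"
    and y: "\<And>w. mul w y = 0"
  shows "y = 0"
proof (rule ccontr)
  assume y0: "y \<noteq> 0"
  interpret cubic_product mul by (rule mul(1))
  have y': "mul y w = 0" for w using y mul_commute by metis
  have ev: "meval f (a *s y + b *s u) = b ^ 3 * meval f u" for a b u
    unfolding mul(2)
    by (simp add: mul_simps dot_simps y y' dot_mul_commute[of u u y] power3_eq_cube mult_ac)
  have "pt y \<in> proj_zeros {f}" using y0 by (auto simp: proj_zeros_def mul(2) y)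
  moreover have "line_through (pt y) q \<subseteq> proj_zeros {f}" if q: "q \<in> proj_zeros {f}" for q
  proof -
    obtain u where u: "q = pt u" "meval f u = 0" using q by (auto simp: proj_zeros_def)
    have "meval f w = 0" if w: "w \<in> vec.span (pt y \<union> pt u)" for w
    proof -
      have "vec.span (pt y \<union> pt u) \<subseteq> vec.span {y, u}"
        unfolding pt_def by (intro vec.span_minimal Un_least vec.span_mono) auto
      then have "w \<in> vec.span {y, u}" using w by auto
      then obtain a b where "w - a *s y = b *s u"
        by (auto simp: vec.span_breakdown_eq vec.span_singleton)
      then have "w = a *s y + b *s u" by (simp add: algebra_simps)
      then show ?thesis using ev u by simp
    qed
    then show ?thesis by (auto simp: line_through_def proj_linear_def proj_zeros_def u(1))
  qed
  ultimately show False using cone unfolding is_cone_def by blast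
qed

lemma vanishing_hessian_singular:
  fixes f :: "('n::finite, 'a::field_char_0) mpol"
  assumes mul: "cubic_product mul"
    "\<And>i j v. meval (mderiv i (mderiv j f)) v = 6 * mul v (axis i 1) $ j"
    and hess: "vanishing_hessian f"
  shows "\<exists>y. y \<noteq> 0 \<and> mul x y = 0"
proof -
  interpret cubic_product mul by (rule mul(1))
  let ?H = "\<chi> i j. meval (hessian f $ i $ j) x"
  have "det ?H = 0" using hess meval_det[of "hessian f" x] by (simp add: vanishing_hessian_def)
  then have "\<not> invertible ?H" by (simp add: invertible_det_nz)
  then obtain y where y: "?H *v y = 0" "y \<noteq> 0"
    unfolding invertible_left_inverse matrix_left_invertible_ker by blast
  have "mul x y $ i = 0" for i
  proof -
    have "6 * (mul x y $ i) = 6 * dot (mul x (axis i 1)) y"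
      by (simp add: dot_mul_commute[of x _ y] dot_axis)
    also have "\<dots> = (?H *v y) $ i"
      by (simp add: matrix_vector_mult_def hessian_def mul(2) dot_def sum_distrib_left mult_ac)
    finally show ?thesis by (simp add: y)
  qed
  then show ?thesis using y(2) by (auto simp: vec_eq_iff)
qed

section \<open>Singular locus and equation\<close>

lemma perazzo_grad_eq_0_iff: "perazzo_grad x = 0 \<longleftrightarrow> x $ 3 = 0 \<and> x $ 4 = (0 :: 'a::field_char_0)"
  by (auto simp: perazzo_grad_def vec5_eq_iff)

text \<open>The cubic \<open>f\<close> is the Perazzo cubic in the coordinates \<open>A *v v\<close>, and its gradient is the pullback of
  the one of the Perazzo cubic; \<open>E\<close> is the inverse of \<open>A\<close>.\<close>

locale perazzo_form =
  fixes f :: "(5, 'a::{alg_closed_field, field_char_0}) mpol" and A E :: "'a ^ 5 ^ 5"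
  assumes AE: "A ** E = mat 1" "E ** A = mat 1"
    and fA: "meval f v = perazzo (A *v v)"
    and gradA: "dot (\<chi> i. meval (mderiv i f) v) w = dot (perazzo_grad (A *v v)) (A *v w)"
begin

lemma invA: "invertible A"
  using AE by (auto simp: invertible_def)

lemma A_E [simp]: "A *v (E *v v) = v" and E_A [simp]: "E *v (A *v v) = v"
  by (simp_all add: matrix_vector_mul_assoc AE)

lemma proj_zeros_f: "proj_zeros {f} = {pt v |v. v \<noteq> 0 \<and> perazzo (A *v v) = 0}"
  by (simp add: proj_zeros_def fA)

lemma pt_in_proj_zeros_f: "pt v \<in> proj_zeros {f} \<longleftrightarrow> v \<noteq> 0 \<and> perazzo (A *v v) = 0"
  unfolding proj_zeros_f
  by (rule pt_mem_Collect) (simp add: vec.scale perazzo_scale)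

lemma grad_eq_0_iff: "(\<forall>i. meval (mderiv i f) v = 0) \<longleftrightarrow> (A *v v) $ 3 = 0 \<and> (A *v v) $ 4 = 0"
proof -
  have "(\<forall>i. meval (mderiv i f) v = 0) \<longleftrightarrow> (\<chi> i. meval (mderiv i f) v) = 0"
    by (simp add: vec_eq_iff)
  also have "\<dots> \<longleftrightarrow> perazzo_grad (A *v v) = 0"
  proof
    assume "(\<chi> i. meval (mderiv i f) v) = 0"
    then have "dot (perazzo_grad (A *v v)) w = dot 0 w" for w
      using gradA[of v "E *v w"] by simp
    then show "perazzo_grad (A *v v) = 0" by (rule dot_eqI)
  next
    assume "perazzo_grad (A *v v) = 0"
    then show "(\<chi> i. meval (mderiv i f) v) = 0"
      using gradA[of v] by (intro dot_eqI) simp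
  qed
  finally show ?thesis by (simp add: perazzo_grad_eq_0_iff)
qed

lemma sing_red_f: "sing_red f = {pt v |v. v \<noteq> 0 \<and> (A *v v) $ 3 = 0 \<and> (A *v v) $ 4 = 0}"
  unfolding sing_red_def proj_zeros_def by (simp flip: grad_eq_0_iff)

lemma pt_in_sing_red_f: "pt v \<in> sing_red f \<longleftrightarrow> v \<noteq> 0 \<and> (A *v v) $ 3 = 0 \<and> (A *v v) $ 4 = 0"
  unfolding sing_red_f by (rule pt_mem_Collect) (simp add: vec.scale)

lemma proj_plane_sing_red: "proj_plane (sing_red f)"
proof -
  let ?W = "{v. (A *v v) $ 3 = 0 \<and> (A *v v) $ 4 = 0}"
  let ?B = "{axis 0 1, axis 1 1, axis 2 1} :: ('a ^ 5) set"
  have "vec.subspace ?W" by (auto simp: vec.subspace_def vec.add vec.scale)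
  moreover have "vec.dim ?W = 3"
  proof (rule vec.dim_unique)
    show "(*v) E ` ?B \<subseteq> ?W" by (auto simp: axis_def)
    show "?W \<subseteq> vec.span ((*v) E ` ?B)"
    proof
      fix v assume v: "v \<in> ?W"
      have "A *v v = (A *v v) $ 0 *s axis 0 1 + (A *v v) $ 1 *s axis 1 1 + (A *v v) $ 2 *s axis 2 1"
        using v by (simp add: vec5_eq_iff axis_def)
      also have "\<dots> \<in> vec.span ?B"
        by (intro vec.span_add vec.span_scale vec.span_base) auto
      finally have "E *v (A *v v) \<in> (*v) E ` vec.span ?B" by blast
      then show "v \<in> vec.span ((*v) E ` ?B)"
        unfolding vec.linear_span_image[OF matrix_vector_mul_linear_gen] by simp
    qed
    have inj: "inj ((*v) E)" by (rule inj_on_inverseI[of _ "(*v) A"]) simp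
    have "?B \<subseteq> cart_basis" by (auto simp: cart_basis_def)
    then have "vec.independent ?B" using independent_cart_basis vec.independent_mono by blast
    then show "vec.independent ((*v) E ` ?B)"
      using inj by (intro vec.linear_independent_injective_image) (auto intro: inj_on_subset)
    have "card ((*v) E ` ?B) = card ?B"
      by (rule card_image[OF inj_on_subset[OF inj subset_UNIV]])
    also have "\<dots> = 3" by (simp add: axis_eq_axis)
    finally show "card ((*v) E ` ?B) = 3" .
  qed
  moreover have "sing_red f = proj_linear ?W"
    unfolding sing_red_f proj_linear_def by auto
  ultimately show ?thesis unfolding proj_plane_def by blast
qed

lemma proj_image_zeros: "proj_image A (proj_zeros {f}) = {pt w |w. w \<noteq> 0 \<and> perazzo w = 0}"
  unfolding proj_zeros_f by (rule proj_image_Collect[OF invA])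

lemma proj_equivalent_perazzo: "proj_equivalent (proj_zeros {f})
    (proj_zeros {mvar 0 * mvar 3 ^ 2 + 2 * mvar 1 * mvar 3 * mvar 4 + mvar 2 * mvar 4 ^ 2})"
  unfolding proj_equivalent_def
proof (intro exI[of _ A] conjI invA)
  show "proj_image A (proj_zeros {f}) =
      proj_zeros {mvar 0 * mvar 3 ^ 2 + 2 * mvar 1 * mvar 3 * mvar 4 + mvar 2 * mvar 4 ^ 2}"
    unfolding proj_image_zeros by (simp add: proj_zeros_def meval_simps perazzo_def)
qed

end

lemma cubic_normal_form:
  fixes f :: "(5, 'a::{alg_closed_field, field_char_0}) mpol"
  assumes f: "homogeneous 3 f" "vanishing_hessian f" "\<not> is_cone (proj_zeros {f})"
  obtains A E :: "'a ^ 5 ^ 5" where "perazzo_form f A E"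
proof -
  obtain mul where mul: "cubic_product mul" "\<And>v. meval f v = dot (mul v v) v"
    "\<And>i v. meval (mderiv i f) v = 3 * mul v v $ i"
    "\<And>i j v. meval (mderiv i (mderiv j f)) v = 6 * mul v (axis i 1) $ j"
    by (rule cubic_form_polarization[OF f(1)]) blast
  interpret cubic_product mul by (rule mul(1))
  interpret degenerate_hessian5 mul
  proof unfold_locales
    show "y = 0" if "\<And>w. mul w y = 0" for y
      by (rule nondegenerate_if_not_cone[OF mul(1,2) f(3) that])
    show "\<exists>y. y \<noteq> 0 \<and> mul x y = 0" for x
      by (rule vanishing_hessian_singular[OF mul(1,4) f(2)])
  qed
  obtain E where E: "invertible E" "\<And>c. dot (mul (E *v c) (E *v c)) (E *v c) = perazzo c"
    using normal_form by metis
  obtain A where A: "A ** E = mat 1" "E ** A = mat 1" using E(1) by (auto simp: invertible_def)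
  have EA: "E *v (A *v v) = v" for v by (simp add: matrix_vector_mul_assoc A)
  have val: "dot (mul v v) v = perazzo (A *v v)" for v using E(2)[of "A *v v"] by (simp add: EA)
  have "dot (\<chi> i. meval (mderiv i f) v) w = dot (perazzo_grad (A *v v)) (A *v w)" for v w
  proof -
    have "dot (\<chi> i. meval (mderiv i f) v) w = 3 * dot (mul v v) w"
      by (simp add: mul(3) dot_def sum_distrib_left mult_ac)
    moreover have "6 * dot (mul v v) w = 2 * dot (perazzo_grad (A *v v)) (A *v w)"
      unfolding cubic_odd_part[symmetric] val perazzo_odd_part[symmetric]
      by (simp add: matrix_vector_right_distrib matrix_vector_mult_diff_distrib)
    ultimately show ?thesis by (simp add: mult_left_cancel)
  qed
  then have "perazzo_form f A E" using A mul(2) val by unfold_locales simp_all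
  then show thesis by (rule that)
qed

section \<open>Projection of the Segre variety\<close>

text \<open>Where \<open>(x\<^sub>3, x\<^sub>4)\<close> is proportional to \<open>(a\<^sub>0, a\<^sub>1)\<close>, the Perazzo cubic imposes the linear condition
  \<open>a\<^sub>0\<^sup>2 x\<^sub>0 + 2 a\<^sub>0 a\<^sub>1 x\<^sub>1 + a\<^sub>1\<^sup>2 x\<^sub>2 = 0\<close>, whose solutions are spanned by \<open>(- 2 a\<^sub>1, a\<^sub>0, 0)\<close> and \<open>(0, a\<^sub>1, - 2 a\<^sub>0)\<close>.
  Writing \<open>b\<^sub>1\<close>, \<open>b\<^sub>2\<close> for the coefficients and \<open>b\<^sub>0\<close> for the factor of proportionality makes all
  coordinates linear in the products of the \<open>a\<^sub>i\<close> and the \<open>b\<^sub>j\<close>.\<close>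

definition segre_projection :: "'a::field ^ (2 \<times> 3) ^ 5" where
  "segre_projection = matrix (\<lambda>z. vec5 (- 2 * z $ (1, 1)) (z $ (0, 1) + z $ (1, 2)) (- 2 * z $ (0, 2))
     (z $ (0, 0)) (z $ (1, 0)))"

lemma segre_projection_works: "segre_projection *v z =
    vec5 (- 2 * z $ (1, 1)) (z $ (0, 1) + z $ (1, 2)) (- 2 * z $ (0, 2)) (z $ (0, 0)) (z $ (1, 0))"
  unfolding segre_projection_def
  by (rule matrix_works, rule linear_vecI) (simp_all add: vec5_eq_iff algebra_simps)

text \<open>The generator of the kernel of the projection; it has rank two as a 2 by 3 matrix.\<close>

definition segre_center :: "'a::field ^ (2 \<times> 3)" where
  "segre_center = (\<chi> ij. if ij = (0, 1) then 1 else if ij = (1, 2) then -1 else 0)"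

lemma vec_2_3_eq_iff: "y = (z :: 'a ^ (2 \<times> 3)) \<longleftrightarrow> y $ (0, 0) = z $ (0, 0) \<and> y $ (0, 1) = z $ (0, 1) \<and>
    y $ (0, 2) = z $ (0, 2) \<and> y $ (1, 0) = z $ (1, 0) \<and> y $ (1, 1) = z $ (1, 1) \<and> y $ (1, 2) = z $ (1, 2)"
  unfolding vec_eq_iff split_paired_All forall_2_0 forall_3_0 by blast

lemma segre_center_nth [simp]: "segre_center $ (0, 0) = 0" "segre_center $ (0, 1) = 1"
  "segre_center $ (0, 2) = 0" "segre_center $ (1, 0) = 0" "segre_center $ (1, 1) = 0"
  "segre_center $ (1, 2) = - 1"
  by (simp_all add: segre_center_def)

lemma segre_center_nonzero: "segre_center \<noteq> 0"
  unfolding vec_2_3_eq_iff by simp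

lemma projection_from_segre_center:
  "projection_from (pt (segre_center :: 'a::field_char_0 ^ (2 \<times> 3))) segre_projection"
proof -
  have "segre_projection *v z = 0 \<longleftrightarrow> z \<in> pt (segre_center :: 'a ^ (2 \<times> 3))" for z
  proof
    assume "segre_projection *v z = 0"
    then have "z = z $ (0, 1) *s segre_center"
      unfolding vec_2_3_eq_iff
      by (simp add: segre_projection_works vec5_eq_iff eq_neg_iff_add_eq_0 add.commute)
    then show "z \<in> pt segre_center" unfolding mem_pt by blast
  next
    assume "z \<in> pt segre_center"
    then show "segre_projection *v z = 0"
      by (auto simp: mem_pt segre_projection_works vec5_eq_iff)
  qed
  then show ?thesis unfolding projection_from_def by blast
qed

lemma segre_center_notin: "pt (segre_center :: 'a::field ^ (2 \<times> 3)) \<notin> segre_1_2"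
proof
  assume "pt (segre_center :: 'a ^ (2 \<times> 3)) \<in> segre_1_2"
  then obtain a :: "'a ^ 2" and b :: "'a ^ 3"
    where "pt segre_center = pt (\<chi> ij. a $ fst ij * b $ snd ij)"
    unfolding segre_1_2_def by blast
  then obtain c where "segre_center = c *s (\<chi> ij. a $ fst ij * b $ snd ij)"
    using pt_eqD by blast
  then have "1 = c * (a $ 0 * b $ 1)" "- 1 = c * (a $ 1 * b $ 2)" "0 = c * (a $ 0 * b $ 2)"
    unfolding vec_2_3_eq_iff by auto
  \<comment> \<open>Matrices of rank one have vanishing minors.\<close>
  moreover have "(c * (a $ 0 * b $ 1)) * (c * (a $ 1 * b $ 2)) = (c * (a $ 0 * b $ 2)) * (c * (a $ 1 * b $ 1))"
    by (simp add: mult_ac)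
  ultimately have "1 * (- 1) = (0 :: 'a) * (c * (a $ 1 * b $ 1))" by metis
  then show False by simp
qed

lemma quadratic_form_zero:
  fixes p q r :: "'a::{alg_closed_field, field_char_0}"
  obtains s t where "(s, t) \<noteq> (0, 0)" "p * s ^ 2 + 2 * q * s * t + r * t ^ 2 = 0"
proof (cases "p = 0")
  case True
  then show thesis using that[of 1 0] by simp
next
  case False
  obtain d where d: "d ^ 2 = q ^ 2 - p * r" using nth_root_exists[of 2] by auto
  have "p * (d - q) ^ 2 + 2 * q * (d - q) * p + r * p ^ 2 = p * (d ^ 2 - (q ^ 2 - p * r))"
    by (simp add: algebra_simps power2_eq_square)
  then show thesis using that[of "d - q" p] False d by simp
qed

text \<open>Over an algebraically closed field the parametrization reaches also the points with
  \<open>x\<^sub>3 = x\<^sub>4 = 0\<close>: the condition on \<open>(a\<^sub>0, a\<^sub>1)\<close> is then a binary quadratic form, which has a zero.\<close>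

lemma proj_image_segre:
  "proj_image segre_projection segre_1_2 =
    {pt w |w. w \<noteq> 0 \<and> perazzo w = (0 :: 'a::{alg_closed_field, field_char_0})}"
proof -
  define h where "h a b = vec5 (- 2 * (a $ 1 * b $ 1)) (a $ 0 * b $ 1 + a $ 1 * b $ 2) (- 2 * (a $ 0 * b $ 2))
     (a $ 0 * b $ 0) (a $ 1 * b $ 0)" for a :: "'a ^ 2" and b :: "'a ^ 3"
  have h: "segre_projection *v (\<chi> ij. a $ fst ij * b $ snd ij) = h a b" for a b
    by (simp add: segre_projection_works h_def)
  have img: "proj_image segre_projection segre_1_2 = {pt (h a b) |a b. a \<noteq> 0 \<and> b \<noteq> 0}"
  proof (intro equalityI subsetI)
    fix p assume "p \<in> proj_image segre_projection (segre_1_2 :: ('a ^ (2 \<times> 3)) set set)"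
    then obtain a b where "p = (*v) segre_projection ` pt (\<chi> ij. a $ fst ij * b $ snd ij)"
      "a \<noteq> 0" "b \<noteq> 0"
      unfolding proj_image_def segre_1_2_def by blast
    then show "p \<in> {pt (h a b) |a b. a \<noteq> 0 \<and> b \<noteq> 0}" by (auto simp: image_pt h)
  next
    fix p assume "p \<in> {pt (h a b) |a b. a \<noteq> 0 \<and> b \<noteq> 0}"
    then obtain a b where ab: "p = (*v) segre_projection ` pt (\<chi> ij. a $ fst ij * b $ snd ij)"
      "a \<noteq> 0" "b \<noteq> 0"
      by (auto simp: image_pt h)
    moreover have "pt (\<chi> ij. a $ fst ij * b $ snd ij) \<in> segre_1_2"
      unfolding segre_1_2_def using ab(2,3) by blast
    ultimately show "p \<in> proj_image segre_projection segre_1_2"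
      unfolding proj_image_def by blast
  qed
  have nz2: "a \<noteq> 0 \<longleftrightarrow> a $ 0 \<noteq> 0 \<or> a $ 1 \<noteq> 0" for a :: "'a ^ 2"
    by (auto simp: vec_eq_iff forall_2_0)
  have nz3: "b \<noteq> 0 \<longleftrightarrow> b $ 0 \<noteq> 0 \<or> b $ 1 \<noteq> 0 \<or> b $ 2 \<noteq> 0" for b :: "'a ^ 3"
    by (auto simp: vec_eq_iff forall_3_0)
  have on_cubic: "h a b \<noteq> 0 \<and> perazzo (h a b) = 0" if "a \<noteq> 0" "b \<noteq> 0" for a b
  proof
    show "h a b \<noteq> 0"
      using that unfolding nz2 nz3 by (auto simp: h_def vec5_eq_iff)
    show "perazzo (h a b) = 0"
      by (simp add: h_def perazzo_def algebra_simps power2_eq_square)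
  qed
  have param: "\<exists>a b. a \<noteq> 0 \<and> b \<noteq> 0 \<and> w = h a b" if w: "w \<noteq> 0" "perazzo w = 0" for w
  proof -
    obtain s t where st: "(s, t) \<noteq> (0, 0)" "w $ 0 * s ^ 2 + 2 * w $ 1 * s * t + w $ 2 * t ^ 2 = 0"
      and k: "\<exists>k. w $ 3 = s * k \<and> w $ 4 = t * k"
    proof (cases "w $ 3 = 0 \<and> w $ 4 = 0")
      case True
      obtain s t where "(s, t) \<noteq> (0, 0)" "w $ 0 * s ^ 2 + 2 * w $ 1 * s * t + w $ 2 * t ^ 2 = 0"
        by (rule quadratic_form_zero)
      then show thesis using that[of s t] True by auto
    next
      case False
      show thesis
        using that[of "w $ 3" "w $ 4"] False w(2) by (auto simp: perazzo_def intro: exI[of _ 1])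
    qed
    obtain k where k: "w $ 3 = s * k" "w $ 4 = t * k" using k by blast
    obtain b1 b2 where b: "w $ 0 = - 2 * (t * b1)" "w $ 1 = s * b1 + t * b2" "w $ 2 = - 2 * (s * b2)"
    proof (cases "t = 0")
      case True
      then have "s \<noteq> 0" "w $ 0 = 0" using st by auto
      then show thesis using that[of "w $ 1 / s" "- w $ 2 / (2 * s)"] True by simp
    next
      case False
      define b1 where "b1 = - w $ 0 / (2 * t)"
      define b2 where "b2 = (w $ 1 - s * b1) / t"
      have e: "w $ 0 = - 2 * (t * b1)" "w $ 1 = s * b1 + t * b2"
        using False by (simp_all add: b1_def b2_def)
      have "t ^ 2 * (w $ 2 + 2 * (s * b2)) = 0"
        using st(2) unfolding e by (simp add: algebra_simps power2_eq_square)
      then have "w $ 2 = - 2 * (s * b2)" using False by (simp add: eq_neg_iff_add_eq_0)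
      then show thesis using that[of b1 b2] e by simp
    qed
    define a :: "'a ^ 2" where "a = (\<chi> i. if i = 0 then s else t)"
    define b :: "'a ^ 3" where "b = (\<chi> i. if i = 0 then k else if i = 1 then b1 else b2)"
    have "w = h a b" using k b by (simp add: h_def a_def b_def vec5_eq_iff)
    moreover have "a \<noteq> 0" using st(1) unfolding nz2 by (auto simp: a_def)
    moreover have "b \<noteq> 0" using w(1) calculation(1) by (auto simp: h_def vec5_eq_iff)
    ultimately show ?thesis by blast
  qed
  show ?thesis
    unfolding img
  proof (intro equalityI subsetI)
    fix p assume "p \<in> {pt (h a b) |a b. a \<noteq> 0 \<and> b \<noteq> 0}"
    then obtain a b where "p = pt (h a b)" "a \<noteq> 0" "b \<noteq> 0" by blast
    then show "p \<in> {pt w |w. w \<noteq> 0 \<and> perazzo w = 0}" using on_cubic[of a b] by blast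
  next
    fix p assume "p \<in> {pt w |w. w \<noteq> 0 \<and> perazzo (w :: 'a ^ 5) = 0}"
    then obtain w where "p = pt w" "w \<noteq> 0" "perazzo w = 0" by blast
    with param[of w] show "p \<in> {pt (h a b) |a b. a \<noteq> 0 \<and> b \<noteq> 0}" by blast
  qed
qed

section \<open>The dual variety\<close>

text \<open>The vanishing of the 2 by 2 minors of the matrix with rows \<open>(w\<^sub>0, w\<^sub>2, w\<^sub>3)\<close> and \<open>(w\<^sub>1, w\<^sub>3, w\<^sub>4)\<close>.\<close>

definition scroll_minors :: "'a::comm_ring_1 ^ 5 \<Rightarrow> bool" where
  "scroll_minors w \<longleftrightarrow> w $ 0 * w $ 3 = w $ 1 * w $ 2 \<and> w $ 0 * w $ 4 = w $ 1 * w $ 3 \<and>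
     w $ 2 * w $ 4 = w $ 3 * w $ 3"

lemma scroll_minors_scale: "scroll_minors w \<Longrightarrow> scroll_minors (c *s w)"
  unfolding scroll_minors_def by (simp add: algebra_simps)

lemma scroll_minors_parametrization:
  fixes w :: "'a::field ^ 5"
  assumes "scroll_minors w"
  obtains s t a b where "(s, t) \<noteq> (0, 0)" "w = vec5 (a * s) (a * t) (b * s ^ 2) (b * (s * t)) (b * t ^ 2)"
proof -
  have m: "w $ 0 * w $ 3 = w $ 1 * w $ 2" "w $ 0 * w $ 4 = w $ 1 * w $ 3" "w $ 2 * w $ 4 = w $ 3 * w $ 3"
    using assms by (auto simp: scroll_minors_def)
  consider "w $ 2 \<noteq> 0" | "w $ 2 = 0" "w $ 4 \<noteq> 0" | "w $ 2 = 0" "w $ 4 = 0" "w $ 0 = 0 \<and> w $ 1 = 0"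
    | "w $ 2 = 0" "w $ 4 = 0" "\<not> (w $ 0 = 0 \<and> w $ 1 = 0)"
    by blast
  then show thesis
  proof cases
    case 1
    then show thesis
      using that[of "w $ 2" "w $ 3" "w $ 0 / w $ 2" "1 / w $ 2"] m
      by (simp add: vec5_eq_iff field_simps power2_eq_square)
  next
    case 2
    then show thesis
      using that[of 0 1 "w $ 1" "w $ 4"] m by (simp add: vec5_eq_iff)
  next
    case 3
    then show thesis
      using that[of 0 1 0 0] m by (simp add: vec5_eq_iff)
  next
    case 4
    then show thesis
      using that[of "w $ 0" "w $ 1" 1 0] m by (simp add: vec5_eq_iff)
  qed
qed

lemma scroll_1_2_minors: "scroll_1_2 = {pt w |w. w \<noteq> 0 \<and> scroll_minors (w :: 'a::field ^ 5)}"
proof (intro equalityI subsetI)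
  fix p :: "('a ^ 5) set" assume "p \<in> scroll_1_2"
  then obtain w s t a b where w: "p = pt w" "(s, t) \<noteq> (0, 0)" "(a, b) \<noteq> (0, 0)"
    "w $ 0 = a * s" "w $ 1 = a * t" "w $ 2 = b * s ^ 2" "w $ 3 = b * (s * t)" "w $ 4 = b * t ^ 2"
    unfolding scroll_1_2_def by blast
  have "w \<noteq> 0" using w by (auto simp: vec5_eq_iff)
  moreover have "scroll_minors w"
    using w by (simp add: scroll_minors_def power2_eq_square mult_ac)
  ultimately show "p \<in> {pt w |w. w \<noteq> 0 \<and> scroll_minors w}" using w(1) by blast
next
  fix p :: "('a ^ 5) set" assume "p \<in> {pt w |w. w \<noteq> 0 \<and> scroll_minors w}"
  then obtain w where w: "p = pt w" "w \<noteq> 0" "scroll_minors w" by blast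
  obtain s t a b where st: "(s, t) \<noteq> (0, 0)"
    "w = vec5 (a * s) (a * t) (b * s ^ 2) (b * (s * t)) (b * t ^ 2)"
    by (rule scroll_minors_parametrization[OF w(3)])
  have "(a, b) \<noteq> (0, 0)" using w(2) st(2) by (auto simp: vec5_eq_iff)
  then have "\<exists>s t a b. (s, t) \<noteq> (0, 0) \<and> (a, b) \<noteq> (0, 0) \<and> w $ 0 = a * s \<and> w $ 1 = a * t \<and>
      w $ 2 = b * s ^ 2 \<and> w $ 3 = b * (s * t) \<and> w $ 4 = b * t ^ 2"
    using st by (intro exI[of _ s] exI[of _ t] exI[of _ a] exI[of _ b]) simp
  then show "p \<in> scroll_1_2" unfolding scroll_1_2_def using w(1) by blast
qed

lemma hyperplane_eq_imp:
  fixes a g :: "'a::field ^ 'n::finite"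
  assumes "hyperplane a = {w. dot g w = 0}" "a \<noteq> 0" "g \<noteq> 0"
  obtains k where "k \<noteq> 0" "a = k *s g"
proof -
  have H: "dot a w = 0 \<longleftrightarrow> dot g w = 0" for w
    using assms(1) by (auto simp: hyperplane_def dot_def)
  obtain i where i: "g $ i \<noteq> 0" using assms(3) by (auto simp: vec_eq_iff)
  then have "dot g ((1 / g $ i) *s axis i 1) = 1" by (simp add: dot_simps dot_axis)
  then obtain w0 where g0: "dot g w0 = 1" by blast
  have "a = dot a w0 *s g"
  proof (rule dot_eqI)
    fix w
    have "dot g (w + (- dot g w) *s w0) = 0"
      unfolding dot_add_right dot_scale_right g0 by simp
    then have "dot a (w + (- dot g w) *s w0) = 0" by (simp only: H)
    then show "dot a w = dot (dot a w0 *s g) w"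
      unfolding dot_add_right dot_scale_right dot_scale_left by (simp add: algebra_simps)
  qed
  then show thesis using that[of "dot a w0"] assms(2) by (metis vec.scale_zero_left)
qed

text \<open>At a point of the Perazzo cubic with \<open>(x\<^sub>3, x\<^sub>4) = (s, t)\<close> the gradient is
  \<open>(s\<^sup>2, 2 s t, t\<^sup>2, c t, - c s)\<close> for some \<open>c\<close>. This permutation and rescaling of coordinates brings it to
  the form \<open>(c s, c t, s\<^sup>2, s t, t\<^sup>2)\<close> of a point of the scroll.\<close>

definition dual_coordinates :: "'a::field ^ 5 \<Rightarrow> 'a ^ 5" where
  "dual_coordinates y = vec5 (- y $ 4) (y $ 3) (y $ 0) (y $ 1 / 2) (y $ 2)"

lemma linear_dual_coordinates: "Vector_Spaces.linear (*s) (*s) dual_coordinates"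
  by (rule linear_vecI) (simp_all add: dual_coordinates_def vec5_eq_iff add_divide_distrib)

lemma dual_coordinates_inj: "dual_coordinates x = dual_coordinates y \<longleftrightarrow> x = (y :: 'a::field_char_0 ^ 5)"
  by (auto simp: dual_coordinates_def vec5_eq_iff)

lemma dual_coordinates_grad: "dual_coordinates (perazzo_grad x) =
    vec5 (- 2 * (x $ 1 * x $ 3 + x $ 2 * x $ 4)) (2 * (x $ 0 * x $ 3 + x $ 1 * x $ 4))
      (x $ 3 ^ 2) (x $ 3 * x $ 4) (x $ 4 ^ 2 :: 'a::field_char_0)"
  by (simp add: dual_coordinates_def perazzo_grad_def vec5_eq_iff)

lemma scroll_minors_grad:
  fixes x :: "'a::field_char_0 ^ 5"
  assumes "perazzo x = 0" shows "scroll_minors (dual_coordinates (perazzo_grad x))"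
proof -
  have "(x $ 1 * x $ 3 + x $ 2 * x $ 4) * x $ 4 = - ((x $ 0 * x $ 3 + x $ 1 * x $ 4) * x $ 3)"
    using assms by (simp add: perazzo_def algebra_simps power2_eq_square eq_neg_iff_add_eq_0)
  then have e: "- 2 * (x $ 1 * x $ 3 + x $ 2 * x $ 4) * x $ 4 = 2 * (x $ 0 * x $ 3 + x $ 1 * x $ 4) * x $ 3"
    by (simp only: mult.assoc) simp
  show ?thesis
    unfolding scroll_minors_def dual_coordinates_grad vec5_nth
    using arg_cong[OF e, of "\<lambda>z. x $ 3 * z"] arg_cong[OF e, of "\<lambda>z. x $ 4 * z"]
    by (simp add: algebra_simps power2_eq_square)
qed

text \<open>Every point of the scroll away from the directrix line \<open>b = 0\<close> is, up to a factor, the gradient at a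
  point of the cubic.\<close>

lemma scroll_point_is_grad:
  fixes s t a b :: "'a::field_char_0"
  assumes "(s, t) \<noteq> (0, 0)" "b \<noteq> 0"
  obtains x where "perazzo x = 0" "x $ 3 = s" "x $ 4 = t"
    "vec5 (a * s) (a * t) (b * s ^ 2) (b * (s * t)) (b * t ^ 2) = b *s dual_coordinates (perazzo_grad x)"
proof -
  \<comment> \<open>The point has to satisfy \<open>x\<^sub>1 s + x\<^sub>2 t = - m s\<close> and \<open>x\<^sub>0 s + x\<^sub>1 t = m t\<close>.\<close>
  define m where "m = a / (2 * b)"
  have a: "a = 2 * b * m" using assms(2) by (simp add: m_def)
  define x where "x = (if s = 0 then vec5 0 m 0 s t else vec5 (2 * m * t / s) (- m) 0 s t)"
  have e: "x $ 1 * s + x $ 2 * t = - m * s" "x $ 0 * s + x $ 1 * t = m * t" "x $ 3 = s" "x $ 4 = t"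
    by (auto simp: x_def)
  have "perazzo x = s * (x $ 0 * s + x $ 1 * t) + t * (x $ 1 * s + x $ 2 * t)"
    by (simp add: perazzo_def e(3,4) algebra_simps power2_eq_square)
  then have "perazzo x = 0" by (simp add: e)
  then show thesis
    using e(3,4) that[of x] unfolding dual_coordinates_grad e by (simp add: vec5_eq_iff a)
qed

context perazzo_form
begin

text \<open>The linear change of the dual coordinates that takes the dual variety to the scroll; functionals are
  first pulled back along \<open>E\<close> to the coordinates of the normal form.\<close>

definition dual_map :: "'a ^ 5 ^ 5" where
  "dual_map = matrix dual_coordinates ** transpose E"

lemma dual_map_works: "dual_map *v a = dual_coordinates (transpose E *v a)"
  unfolding dual_map_def
  by (simp add: matrix_vector_mul_assoc[symmetric] matrix_works[OF linear_dual_coordinates])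

lemma dot_transpose: "dot (transpose E *v a) w = dot a (E *v w)"
  unfolding dot_def matrix_vector_mult_def transpose_def
  by (simp add: sum_distrib_left sum_distrib_right) (subst sum.swap, simp add: mult_ac)

lemma dual_map_grad: "dual_map *v (\<chi> i. meval (mderiv i f) v) = dual_coordinates (perazzo_grad (A *v v))"
proof -
  have "transpose E *v (\<chi> i. meval (mderiv i f) v) = perazzo_grad (A *v v)"
    by (rule dot_eqI) (simp only: dot_transpose gradA A_E)
  then show ?thesis by (simp add: dual_map_works)
qed

lemma dual_map_ker: "dual_map *v a = 0 \<Longrightarrow> a = 0"
proof -
  assume "dual_map *v a = 0"
  then have "dual_coordinates (transpose E *v a) = dual_coordinates 0"
    unfolding dual_map_works by (simp add: dual_coordinates_def vec5_eq_iff)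
  then have "transpose E *v a = 0" by (simp only: dual_coordinates_inj)
  then have "dot a w = dot 0 w" for w
    using dot_transpose[of a "A *v w"] by (simp only: E_A dot_zero_left)
  then show "a = 0" by (rule dot_eqI)
qed

lemma invertible_dual_map: "invertible dual_map"
  unfolding invertible_left_inverse matrix_left_invertible_ker using dual_map_ker by blast

text \<open>The hyperplanes tangent at smooth points, of which the dual variety is the closure.\<close>

definition conormal_points :: "('a ^ 5) set set" where
  "conormal_points = {pt a |a. a \<noteq> 0 \<and> (\<exists>v. v \<noteq> 0 \<and> pt v \<in> proj_zeros {f} - sing_red f \<and>
                            hyperplane a = tangent_space f v)}"

lemma conormal_points_subset:
  "conormal_points \<subseteq> {pt a |a. a \<noteq> 0 \<and> scroll_minors (dual_map *v a)}"
proof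
  fix p assume "p \<in> conormal_points"
  then obtain a v where a: "p = pt a" "a \<noteq> 0" and v: "v \<noteq> 0" "pt v \<in> proj_zeros {f}" "pt v \<notin> sing_red f"
    and H: "hyperplane a = tangent_space f v"
    unfolding conormal_points_def by blast
  let ?g = "\<chi> i. meval (mderiv i f) v"
  have "\<not> (\<forall>i. meval (mderiv i f) v = 0)"
    using v unfolding pt_in_sing_red_f grad_eq_0_iff by blast
  then have "?g \<noteq> 0" by (simp add: vec_eq_iff)
  moreover have "hyperplane a = {w. dot ?g w = 0}"
    unfolding H by (simp add: tangent_space_def dot_def)
  ultimately obtain k where k: "a = k *s ?g" using hyperplane_eq_imp a(2) by blast
  have "perazzo (A *v v) = 0"
    using v(2) unfolding pt_in_proj_zeros_f by blast
  then have "scroll_minors (k *s (dual_map *v ?g))"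
    unfolding dual_map_grad by (intro scroll_minors_scale scroll_minors_grad)
  then have "scroll_minors (dual_map *v a)" by (simp add: k vec.scale)
  then show "p \<in> {pt a |a. a \<noteq> 0 \<and> scroll_minors (dual_map *v a)}" using a by blast
qed

lemma conormal_pointI:
  assumes st: "(s, t) \<noteq> (0, 0)" "b \<noteq> 0"
    and a: "dual_map *v a = vec5 (c * s) (c * t) (b * s ^ 2) (b * (s * t)) (b * t ^ 2)"
  shows "a \<noteq> 0 \<and> pt a \<in> conormal_points"
proof -
  obtain x where x: "perazzo x = 0" "x $ 3 = s" "x $ 4 = t"
    "vec5 (c * s) (c * t) (b * s ^ 2) (b * (s * t)) (b * t ^ 2) = b *s dual_coordinates (perazzo_grad x)"
    by (rule scroll_point_is_grad[OF st])
  let ?v = "E *v x"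
  let ?g = "\<chi> i. meval (mderiv i f) ?v"
  have "dual_map *v a = dual_map *v (b *s ?g)"
    unfolding vec.scale dual_map_grad a x(4) by simp
  then have "dual_map *v (a - b *s ?g) = 0" by (simp add: matrix_vector_mult_diff_distrib)
  then have ag: "a = b *s ?g" using dual_map_ker by fastforce
  have v0: "?v \<noteq> 0"
  proof
    assume "?v = 0"
    then have "A *v ?v = 0" by simp
    then have "x = 0" by simp
    then show False using x st by simp
  qed
  have "pt ?v \<in> proj_zeros {f}"
    using v0 x(1) unfolding pt_in_proj_zeros_f by simp
  moreover have "pt ?v \<notin> sing_red f"
    unfolding pt_in_sing_red_f using x st by simp
  moreover have "hyperplane a = tangent_space f ?v"
  proof -
    have "hyperplane a = {w. dot a w = 0}" by (simp add: hyperplane_def dot_def)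
    also have "\<dots> = {w. dot ?g w = 0}" using st(2) by (simp add: ag dot_scale_left)
    also have "\<dots> = tangent_space f ?v" by (simp add: tangent_space_def dot_def)
    finally show ?thesis .
  qed
  moreover have "a \<noteq> 0"
  proof
    assume "a = 0"
    then have "dual_map *v a = 0" by simp
    then show False using a st by (auto simp: vec5_eq_iff)
  qed
  ultimately show ?thesis unfolding conormal_points_def using v0 by blast
qed

lemma zariski_closed_scroll:
  "zariski_closed {pt a |a. a \<noteq> 0 \<and> scroll_minors (dual_map *v a)}"
proof -
  define L :: "5 \<Rightarrow> (5, 'a) mpol" where "L k = (\<Sum>i\<in>UNIV. Poly_Mapping.single (Poly_Mapping.single i 1) (dual_map $ k $ i))"
    for k
  have hL: "homogeneous 1 (L k)" for k
    using homogeneous_linear_form[of "dual_map $ k"] by (simp add: L_def)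
  have eL: "meval (L k) a = (dual_map *v a) $ k" for k a
    by (simp add: L_def meval_sum meval_single monomial_single matrix_vector_mult_def)
  let ?F = "{L 0 * L 3 - L 1 * L 2, L 0 * L 4 - L 1 * L 3, L 2 * L 4 - L 3 * L 3}"
  have hLL: "homogeneous 2 (L i * L j)" for i j
    using homogeneous_mult[OF hL hL, of i j] by (simp only: one_add_one)
  have "homogeneous 2 g" if "g \<in> ?F" for g
    using that by (auto intro!: homogeneous_diff hLL)
  moreover have "{pt a |a. a \<noteq> 0 \<and> scroll_minors (dual_map *v a)} = proj_zeros ?F"
    by (simp add: proj_zeros_def meval_simps eL scroll_minors_def)
  ultimately show ?thesis unfolding zariski_closed_def by blast
qed

text \<open>The hyperplanes tangent at smooth points give the points of the scroll off the directrix line. A point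
  of the directrix lies on a ruling whose other points are all of this kind, and a polynomial that vanishes
  at them vanishes at that point as well.\<close>

lemma dual_variety_f: "dual_variety f = {pt a |a. a \<noteq> 0 \<and> scroll_minors (dual_map *v a)}"
proof -
  have "dual_variety f = zariski_closure conormal_points"
    by (simp add: dual_variety_def conormal_points_def)
  also have "\<dots> = {pt a |a. a \<noteq> 0 \<and> scroll_minors (dual_map *v a)}"
  proof
    show "zariski_closure conormal_points \<subseteq> {pt a |a. a \<noteq> 0 \<and> scroll_minors (dual_map *v a)}"
      unfolding zariski_closure_def using zariski_closed_scroll conormal_points_subset by blast
    show "{pt a |a. a \<noteq> 0 \<and> scroll_minors (dual_map *v a)} \<subseteq> zariski_closure conormal_points"
      unfolding zariski_closure_def
    proof (intro subsetI InterI)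
      fix p Z assume p: "p \<in> {pt a |a. a \<noteq> 0 \<and> scroll_minors (dual_map *v a)}"
        and Z: "Z \<in> {Z. zariski_closed Z \<and> conormal_points \<subseteq> Z}"
      obtain F where F: "\<forall>g\<in>F. \<exists>d. homogeneous d g" "Z = proj_zeros F"
        using Z unfolding zariski_closed_def by blast
      have zero: "meval g a = 0" if g: "g \<in> F" "pt a \<in> conormal_points" for g a
      proof -
        obtain u where u: "pt a = pt u" "meval g u = 0"
          using g Z F(2) by (auto simp: proj_zeros_def)
        obtain c where "a = c *s u" using pt_eqD[OF u(1)] by blast
        moreover obtain d where "homogeneous d g" using F(1) g(1) by blast
        ultimately show ?thesis using u(2) by (simp add: meval_homogeneous_scale)
      qed
      obtain a where a: "p = pt a" "a \<noteq> 0" "scroll_minors (dual_map *v a)" using p by blast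
      obtain s t c b where st: "(s, t) \<noteq> (0, 0)"
        "dual_map *v a = vec5 (c * s) (c * t) (b * s ^ 2) (b * (s * t)) (b * t ^ 2)"
        by (rule scroll_minors_parametrization[OF a(3)])
      have "meval g a = 0" if g: "g \<in> F" for g
      proof (cases "b = 0")
        case False
        then show ?thesis using zero[OF g] conormal_pointI[OF st(1) False st(2)] by blast
      next
        case True
        obtain B where B: "dual_map ** B = mat 1" using invertible_dual_map by (auto simp: invertible_def)
        \<comment> \<open>The direction of the ruling through the point, towards the conic.\<close>
        define q where "q = B *v vec5 0 0 (s ^ 2) (s * t) (t ^ 2)"
        have q: "dual_map *v q = vec5 0 0 (s ^ 2) (s * t) (t ^ 2)"
          by (simp add: q_def matrix_vector_mul_assoc B)
        have "meval g (a + r *s q) = 0" if r: "r \<noteq> 0" for r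
        proof -
          have "dual_map *v (a + r *s q) = vec5 (c * s) (c * t) (r * s ^ 2) (r * (s * t)) (r * t ^ 2)"
            unfolding vec.add vec.scale q st(2) True by (simp add: vec5_eq_iff)
          then show ?thesis using zero[OF g] conormal_pointI[OF st(1) r] by blast
        qed
        then show ?thesis
          by (rule line_poly_zero_on_punctured_line[OF line_poly_meval])
      qed
      then show "p \<in> Z" using a F(2) by (auto simp: proj_zeros_def)
    qed
  qed
  finally show ?thesis .
qed

lemma proj_equivalent_dual_scroll: "proj_equivalent (dual_variety f) scroll_1_2"
  unfolding proj_equivalent_def scroll_1_2_minors dual_variety_f
  using invertible_dual_map proj_image_Collect[OF invertible_dual_map, of scroll_minors] by blast

end

theorem theorem4p2:
  fixes f :: "(5, 'a::{alg_closed_field, field_char_0}) mpol"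
    and X :: "('a ^ 5) set set"
  assumes "homogeneous 3 f"
    and "irreducible f"
    and "X = proj_zeros {f}"
    and "vanishing_hessian f"
    and "\<not> is_cone X"
  shows "proj_plane (sing_red f) \<and>
    proj_equivalent (dual_variety f) scroll_1_2 \<and>
    (\<exists>(z :: 'a ^ (2 \<times> 3)) (M :: 'a ^ (2 \<times> 3) ^ 5).
       z \<noteq> 0 \<and> pt z \<notin> segre_1_2 \<and> projection_from (pt z) M \<and>
       proj_equivalent X (proj_image M segre_1_2)) \<and>
    proj_equivalent X
      (proj_zeros {mvar 0 * mvar 3 ^ 2 + 2 * mvar 1 * mvar 3 * mvar 4 + mvar 2 * mvar 4 ^ 2})"
proof -
  obtain A E :: "'a ^ 5 ^ 5" where "perazzo_form f A E"
    using cubic_normal_form[of f] assms by metis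
  then interpret perazzo_form f A E .
  have "proj_equivalent X (proj_image segre_projection segre_1_2)"
    unfolding proj_equivalent_def proj_image_segre assms(3)
    using proj_image_zeros invA by blast
  then have "\<exists>(z :: 'a ^ (2 \<times> 3)) (M :: 'a ^ (2 \<times> 3) ^ 5).
       z \<noteq> 0 \<and> pt z \<notin> segre_1_2 \<and> projection_from (pt z) M \<and>
       proj_equivalent X (proj_image M segre_1_2)"
    using segre_center_nonzero segre_center_notin projection_from_segre_center by blast
  then show ?thesis
    using proj_plane_sing_red proj_equivalent_dual_scroll proj_equivalent_perazzo assms(3) by blast
qed

end
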